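(* Let $p$ be a prime, let $a$ be a positive integer, let $l,n\in\mathbb{N}$, $r\in\mathbb{Z}$ and $s,t\in\{0,\ldots,p^{a-1}-1\}$. Let $m\in\mathbb{N}$ with $m\equiv-n\pmod p$. Suppose one of the following holds: (i) $a=1$, or $p\mid n$, or $p-1\nmid n-l-1$; (ii) $\lfloor s/p^{a-2}\rfloor=2\lfloor t/p^{a-2}\rfloor$ and $p\ne2$; (iii) $\lfloor s/p^{a-2}\rfloor=\lfloor t/p^{a-2}\rfloor=p-1$. Then $$(-1)^{l+t-1}F^{(l)}_{p^a}(p^{a-1}n+s,\,p^{a-1}r+t)\equiv[\![n>l]\!]\binom st\binom{\lfloor(n-l-1)/(p-1)\rfloor}{l}\,(n-l)_*!\,B^{(m)}_{(n-l)^*}(-r)\pmod p.$$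
   Context: For a prime $p$, $a\in\mathbb{Z}^+$, $l,n\in\mathbb{N}$ and $r\in\mathbb{Z}$, the extended Fleck quotient is $$F^{(l)}_{p^a}(n,r)=(-p)^{-\lfloor (n-lp^a-p^{a-1})/\varphi(p^a)\rfloor}\sum_{k\equiv r\,(\mathrm{mod}\ p^a)}\binom nk(-1)^k\binom{(k-r)/p^a}{l},$$ which is an integer ($\varphi$ is Euler's totient function). $[\![A]\!]$ is $1$ if $A$ holds and $0$ otherwise. For an integer $x$, $x_*$ denotes the smallest positive residue of $x$ modulo $p-1$ and $x^*$ the least nonnegative residue of $-x$ modulo $p-1$. For $m\in\mathbb{N}$ the $m$th order Bernoulli polynomials are given by $\frac{x^me^{tx}}{(e^x-1)^m}=\sum_{k\ge0}B^{(m)}_k(t)\frac{x^k}{k!}$. Congruences between rationals modulo $p$ mean the difference divided by $p$ is a $p$-adic integer. *)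

theory Defs
  imports
    "HOL-Computational_Algebra.Computational_Algebra"
    "HOL-Number_Theory.Number_Theory"
begin

(* The binomial coefficient in the summand has an integer, possibly negative, upper argument,
   hence gchoose; terms with k < 0 or k > n vanish because of (n choose k). *)
definition fleck_quotient :: "nat \<Rightarrow> nat \<Rightarrow> nat \<Rightarrow> nat \<Rightarrow> int \<Rightarrow> rat" where
  "fleck_quotient p a l n r =
     (- of_nat p) powi
       (- \<lfloor>(of_nat n - of_nat (l * p ^ a) - of_nat (p ^ (a - 1))) / (of_nat (totient (p ^ a)) :: rat)\<rfloor>)
     * (\<Sum>k | k \<le> n \<and> [int k = r] (mod int (p ^ a)).
          of_nat (n choose k) * (- 1) ^ k
          * ((of_int (int k - r) / of_nat (p ^ a)) gchoose l))"

definition smallest_pos_residue :: "nat \<Rightarrow> int \<Rightarrow> nat" where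
  "smallest_pos_residue p x = (LEAST y. 0 < y \<and> [int y = x] (mod (int p - 1)))"

definition least_nonneg_neg_residue :: "nat \<Rightarrow> int \<Rightarrow> nat" where
  "least_nonneg_neg_residue p x = (LEAST y. [int y = - x] (mod (int p - 1)))"

definition bernoulli_gen_fps :: "nat \<Rightarrow> rat \<Rightarrow> rat fps" where
  "bernoulli_gen_fps m t = (fps_X ^ m * fps_exp t) / (fps_exp 1 - 1) ^ m"

(* Division of formal power series is exact only if the denominator divides the numerator;
   here both have subdegree at least m and the denominator has subdegree m. *)
lemma bernoulli_gen_fps_mult:
  "bernoulli_gen_fps m t * (fps_exp 1 - 1) ^ m = fps_X ^ m * fps_exp t"
proof -
  let ?d = "fps_exp 1 - 1 :: rat fps"
  have nth1: "fps_nth ?d 1 \<noteq> 0" by simp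
  have sd: "subdegree ?d = 1"
    by (rule subdegreeI) auto
  have "?d \<noteq> 0" using nth1 by (metis fps_zero_nth)
  then have "?d dvd fps_X"
    using sd by (simp add: fps_dvd_iff)
  then have "?d ^ m dvd fps_X ^ m * fps_exp t"
    by (simp add: dvd_power_same)
  then show ?thesis
    by (simp add: bernoulli_gen_fps_def)
qed

definition bernoulli_poly :: "nat \<Rightarrow> nat \<Rightarrow> rat \<Rightarrow> rat" where
  "bernoulli_poly m k t = fact k * fps_nth (bernoulli_gen_fps m t) k"

(* The p-adic integers among the rationals: those writable with denominator prime to p. *)
definition padic_integral :: "nat \<Rightarrow> rat \<Rightarrow> bool" where
  "padic_integral p x \<longleftrightarrow> (\<exists>u v :: int. \<not> int p dvd v \<and> x = of_int u / of_int v)"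

definition rat_cong :: "nat \<Rightarrow> rat \<Rightarrow> rat \<Rightarrow> bool" where
  "rat_cong p x y \<longleftrightarrow> padic_integral p ((x - y) / of_nat p)"

end

theory Submission
  imports Defs
begin

text \<open>
  Write \<open>P = p ^ (a - 1)\<close>, let \<open>x\<close> act on sequences as the shift and put \<open>u = 1 - x\<close>. Expanding
  \<open>x ^ (p ^ a) - 1 = (1 - u) ^ (p ^ a) - 1\<close> in powers of \<open>u\<close> expresses the \<open>N + p ^ a\<close>-th Fleck sum
  through earlier ones. Modulo \<open>p\<close>, after division by the right powers of \<open>- p\<close>, only the terms
  with \<open>P dvd j\<close> survive, and they carry the coefficients \<open>1 / i\<close> of a logarithm. The coefficients of
  \<open>((e ^ z - 1) / z) ^ n * e ^ (- r z)\<close>, which modulo \<open>p\<close> are Bernoulli polynomials of order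
  \<open>m \<equiv> - n\<close>, satisfy the same recurrence because \<open>log (1 - (1 - e ^ z)) = z\<close>; for \<open>n < p\<close> both sides
  agree by the congruences of Lucas, Fermat and Wilson.

  The exception is \<open>p - 1 dvd n - l - 1\<close>: there the exponent of \<open>- p\<close> can jump by two, and terms
  with \<open>p ^ (a - 2) dvd j\<close> also contribute. Their total contribution solves a Pascal-type recurrence and is a
  multiple of \<open>n\<close> and of a sum over the digits of \<open>s\<close> and \<open>t\<close>, and each of the three conditions
  makes one of these factors vanish.
\<close>

section \<open>Congruences between rationals modulo a prime\<close>

locale prime_modulus =
  fixes p :: nat
  assumes prime_p: "prime p"
begin

abbreviation pint :: "rat \<Rightarrow> bool" where
  "pint \<equiv> padic_integral p"

abbreviation cong_p :: "rat \<Rightarrow> rat \<Rightarrow> bool" (infix "\<simeq>" 50) where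
  "x \<simeq> y \<equiv> rat_cong p x y"

lemma p_gt1: "p > 1" using prime_p prime_gt_1_nat by blast

lemma p_gt0: "p > 0" using p_gt1 by simp

section \<open>The ring of rationals that are integral at p\<close>

lemma pint_of_int [simp, intro]: "pint (of_int x)"
  unfolding padic_integral_def
  using p_gt1 by (intro exI[of _ x] exI[of _ 1]) auto

lemma pint_of_nat [simp, intro]: "pint (of_nat x)"
  using pint_of_int[of "int x"] by simp

lemma pint_numeral [simp, intro]: "pint 0" "pint 1"
  using pint_of_int[of 0] pint_of_int[of 1] by simp_all

lemma prime_int_p: "prime (int p)" using prime_p by simp

lemma pint_add [intro]:
  assumes "pint x" "pint y" shows "pint (x + y)"
proof -
  obtain u v u' v' where uv: "\<not> int p dvd v" "x = of_int u / of_int v"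
    "\<not> int p dvd v'" "y = of_int u' / of_int v'"
    using assms unfolding padic_integral_def by blast
  have "\<not> int p dvd v * v'"
    using uv prime_int_p prime_dvd_mult_iff by blast
  moreover have "v \<noteq> 0" "v' \<noteq> 0" using uv by auto
  then have "x + y = of_int (u * v' + u' * v) / of_int (v * v')"
    unfolding uv by (simp add: field_simps)
  ultimately show ?thesis unfolding padic_integral_def by blast
qed

lemma pint_mult [intro]:
  assumes "pint x" "pint y" shows "pint (x * y)"
proof -
  obtain u v u' v' where uv: "\<not> int p dvd v" "x = of_int u / of_int v"
    "\<not> int p dvd v'" "y = of_int u' / of_int v'"
    using assms unfolding padic_integral_def by blast
  have "\<not> int p dvd v * v'"
    using uv prime_int_p prime_dvd_mult_iff by blast
  moreover have "x * y = of_int (u * u') / of_int (v * v')"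
    unfolding uv by simp
  ultimately show ?thesis unfolding padic_integral_def by blast
qed

lemma pint_minus [intro]: "pint x \<Longrightarrow> pint (- x)"
  using pint_mult[of "of_int (-1)" x] pint_of_int[of "-1"] by simp

lemma pint_diff [intro]: "pint x \<Longrightarrow> pint y \<Longrightarrow> pint (x - y)"
  using pint_add[of x "- y"] pint_minus[of y] by simp

lemma pint_power [intro]: "pint x \<Longrightarrow> pint (x ^ n)"
  by (induction n) (auto intro: pint_mult)

lemma pint_sum [intro]: "(\<And>i. i \<in> A \<Longrightarrow> pint (f i)) \<Longrightarrow> pint (sum f A)"
  by (induction A rule: infinite_finite_induct) auto

lemma pint_inverse_of_nat:
  assumes "\<not> p dvd j" shows "pint (1 / of_nat j)"
  unfolding padic_integral_def
  using assms by (intro exI[of _ 1] exI[of _ "int j"]) auto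

lemma pint_divide:
  assumes "\<not> p dvd j" "pint x" shows "pint (x / of_nat j)"
  using pint_mult[OF assms(2) pint_inverse_of_nat[OF assms(1)]] by simp

lemma pint_divide_fact:
  assumes "k < p" "pint x" shows "pint (x / fact k)"
  using pint_divide[of "fact k" x] assms prime_p by (simp add: prime_dvd_fact_iff)

section \<open>Calculus of congruences modulo p\<close>

lemma rcong_iff: "x \<simeq> y \<longleftrightarrow> (\<exists>z. pint z \<and> x = y + of_nat p * z)"
proof
  assume "x \<simeq> y"
  then show "\<exists>z. pint z \<and> x = y + of_nat p * z"
    using p_gt0 unfolding rat_cong_def by (intro exI[of _ "(x - y) / of_nat p"]) simp
next
  assume "\<exists>z. pint z \<and> x = y + of_nat p * z"
  then show "x \<simeq> y" using p_gt0 unfolding rat_cong_def by auto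
qed

lemma rcong_refl [simp, intro]: "x \<simeq> x"
  unfolding rcong_iff by (intro exI[of _ 0]) simp

lemma rcong_sym: "x \<simeq> y \<Longrightarrow> y \<simeq> x"
  unfolding rat_cong_def using pint_minus[of "(x - y) / of_nat p"]
  by (simp add: minus_divide_left)

lemma rcong_add:
  assumes "x \<simeq> y" "x' \<simeq> y'" shows "x + x' \<simeq> y + y'"
  using pint_add[OF assms[unfolded rat_cong_def]]
  unfolding rat_cong_def by (simp add: add_divide_distrib[symmetric] algebra_simps)

lemma rcong_trans [trans]:
  assumes "x \<simeq> y" "y \<simeq> z" shows "x \<simeq> z"
  using pint_add[OF assms[unfolded rat_cong_def]]
  unfolding rat_cong_def by (simp add: add_divide_distrib[symmetric])

lemma rcong_eq_trans [trans]: "x \<simeq> y \<Longrightarrow> y = z \<Longrightarrow> x \<simeq> z" "x = y \<Longrightarrow> y \<simeq> z \<Longrightarrow> x \<simeq> z"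
  by simp_all

lemma rcong_cmult:
  assumes "pint c" "x \<simeq> y" shows "c * x \<simeq> c * y"
  using pint_mult[OF assms[unfolded rat_cong_def]]
  unfolding rat_cong_def by (simp add: right_diff_distrib)

lemma rcong_minus: "x \<simeq> y \<Longrightarrow> - x \<simeq> - y"
  using rcong_cmult[of "-1" x y] pint_of_int[of "-1"] by simp

lemma rcong_diff:
  assumes "x \<simeq> y" "x' \<simeq> y'" shows "x - x' \<simeq> y - y'"
  using rcong_add[OF assms(1) rcong_minus[OF assms(2)]] by simp

lemma rcong_mult:
  assumes "x \<simeq> y" "x' \<simeq> y'" "pint x" "pint y'" shows "x * x' \<simeq> y * y'"
  using rcong_trans[OF rcong_cmult[OF assms(3,2)]] rcong_cmult[OF assms(4,1)]
  by (metis mult.commute)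

lemma rcong_sum:
  "(\<And>i. i \<in> A \<Longrightarrow> f i \<simeq> g i) \<Longrightarrow> sum f A \<simeq> sum g A"
  by (induction A rule: infinite_finite_induct) (auto intro: rcong_add)

lemma rcong_pint: "x \<simeq> y \<Longrightarrow> pint y \<Longrightarrow> pint x"
  unfolding rcong_iff by auto

lemma rcong_0_iff: "x \<simeq> 0 \<longleftrightarrow> (\<exists>z. pint z \<and> x = of_nat p * z)"
  unfolding rcong_iff by simp

lemma rcong_0_power:
  assumes "pint x" "n > 0" shows "of_nat p ^ n * x \<simeq> 0"
proof -
  obtain k where "n = Suc k" using assms(2) gr0_implies_Suc by blast
  then show ?thesis
    unfolding rcong_0_iff using assms(1)
    by (intro exI[of _ "of_nat p ^ k * x"]) auto
qed

lemma rcong_of_int: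
  assumes "[x = y] (mod int p)" shows "of_int x \<simeq> of_int y"
proof -
  obtain k where "x = y + int p * k"
    using assms by (metis cong_iff_lin cong_sym_eq mult.commute)
  then show ?thesis unfolding rcong_iff by (intro exI[of _ "of_int k"]) simp
qed

lemma rcong_of_nat: "[x = y] (mod p) \<Longrightarrow> of_nat x \<simeq> of_nat y"
  using rcong_of_int[of "int x" "int y"] by (simp add: cong_int_iff)

lemma rcong_0_dvd: "p dvd n \<Longrightarrow> of_nat n \<simeq> 0"
  using rcong_of_nat[of n 0] by (simp add: cong_0_iff)

lemma rcong_0_mult:
  assumes "x \<simeq> 0" "pint y" shows "x * y \<simeq> 0" "y * x \<simeq> 0"
  using rcong_cmult[OF assms(2,1)] by (simp_all add: mult.commute)

lemma rcong_power:
  assumes "x \<simeq> y" "pint y" shows "x ^ n \<simeq> y ^ n"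
  by (induction n) (use assms in \<open>auto intro!: rcong_mult intro: rcong_pint\<close>)

text \<open>Signs are immaterial modulo 2, so parity has to be checked for odd primes only; this
  treats p = 2 together with the odd primes.\<close>

lemma minus1_power_parity:
  assumes "p \<noteq> 2 \<Longrightarrow> even x \<longleftrightarrow> even y"
  shows "(- 1) ^ x \<simeq> (- 1) ^ y"
proof (cases "p = 2")
  case True
  have "(1::rat) \<simeq> - 1"
    unfolding rcong_iff using True pint_numeral by (intro exI[of _ 1]) simp
  then show ?thesis by (cases "even x"; cases "even y") (auto intro: rcong_sym)
next
  case False
  then show ?thesis using assms by (cases "even x") auto
qed

lemma minus1_power_prime_power: "(- 1) ^ (p ^ a) \<simeq> - 1"
proof -
  have "odd p" if "p \<noteq> 2" using that prime_p prime_odd_nat p_gt1 by force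
  then have "(- 1) ^ (p ^ a) \<simeq> (- 1) ^ 1" by (intro minus1_power_parity) simp
  then show ?thesis by simp
qed

lemma rcong_mult_cancel:
  assumes "\<not> p dvd j" "of_nat j * x \<simeq> of_nat j * y" shows "x \<simeq> y"
proof -
  have "j \<noteq> 0" using assms(1) by (intro notI) simp
  with rcong_cmult[OF pint_inverse_of_nat[OF assms(1)] assms(2)] show ?thesis by simp
qed

section \<open>Binomial coefficients of prime powers; Lucas and Wilson\<close>

lemma choose_prime_power_dvd:
  assumes "0 < j" "j < p ^ b" shows "p dvd (p ^ b choose j)"
proof (rule ccontr)
  assume *: "\<not> p dvd (p ^ b choose j)"
  \<comment> \<open>By absorption j * (q choose j) = q * (q - 1 choose j - 1) with q =
    \<open>p ^ b\<close>. Were the binomial prime to p, the whole power would divide j < q.\<close>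
  have "p ^ b dvd j * (p ^ b choose j)"
    using times_binomial_minus1_eq[OF assms(1), of "p ^ b"] by simp
  then have "p ^ b dvd j"
    using * prime_p prime_imp_coprime coprime_dvd_mult_left_iff coprime_power_left_iff by metis
  then show False using assms dvd_imp_le by force
qed

lemma choose_prime_power_minus1:
  assumes "j < p ^ b" shows "of_nat (p ^ b - 1 choose j) \<simeq> (- 1) ^ j"
  using assms
proof (induction j)
  case (Suc j)
  let ?q = "p ^ b"
  have "?q choose Suc j = (?q - 1 choose j) + (?q - 1 choose Suc j)"
    using p_gt0 by (metis Suc_diff_1 binomial_Suc_Suc zero_less_power)
  then have "(of_nat (?q choose Suc j) :: rat) = of_nat (?q - 1 choose j) + of_nat (?q - 1 choose Suc j)"
    by simp
  then have "of_nat (?q - 1 choose Suc j) = (of_nat (?q choose Suc j) :: rat) - of_nat (?q - 1 choose j)"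
    by simp
  also have "\<dots> \<simeq> 0 - (-1) ^ j"
    using Suc by (intro rcong_diff rcong_0_dvd choose_prime_power_dvd) auto
  finally show ?case by simp
qed simp

text \<open>With q = \<open>p ^ b\<close>, (1 + x)^q is congruent to 1 + x^q, so raising n by one
  acts on the upper digit k as Pascal's rule. The induction on n uses the Vandermonde form of
  this.\<close>

lemma lucas_prime_power:
  assumes "s < p ^ b" "t < p ^ b"
  shows "of_nat (p ^ b * n + s choose (p ^ b * k + t)) \<simeq> of_nat ((n choose k) * (s choose t))"
proof (induction n arbitrary: k)
  case 0
  show ?case
  proof (cases k)
    case (Suc k')
    then show ?thesis using assms by (simp add: binomial_eq_0)
  qed simp
next
  case (Suc n)
  let ?q = "p ^ b" and ?M = "p ^ b * n + s"
  have q0: "?q > 0" using p_gt0 by simp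
  have van: "(of_nat (?q * Suc n + s choose m) :: rat)
      \<simeq> of_nat (?M choose m) + (if ?q \<le> m then of_nat (?M choose (m - ?q)) else 0)" for m
  proof -
    have "?q * Suc n + s = ?q + ?M" by simp
    then have "(of_nat (?q * Suc n + s choose m) :: rat)
       = (\<Sum>j\<le>m. of_nat (?q choose j) * of_nat (?M choose (m - j)))"
      by (metis (no_types, lifting) vandermonde of_nat_sum of_nat_mult sum.cong)
    also have "\<dots> \<simeq> (\<Sum>j\<le>m. (if j = 0 then of_nat (?M choose m) else 0)
         + (if j = ?q then of_nat (?M choose (m - ?q)) else 0))"
    proof (intro rcong_sum)
      fix j assume "j \<in> {..m}"
      consider "j = 0" | "0 < j" "j < ?q" | "j = ?q" | "j > ?q" by linarith
      then show "(of_nat (?q choose j) * of_nat (?M choose (m - j)) :: rat)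
        \<simeq> (if j = 0 then of_nat (?M choose m) else 0)
         + (if j = ?q then of_nat (?M choose (m - ?q)) else 0)"
      proof cases
        case 2
        then show ?thesis by (auto intro!: rcong_0_mult(1) rcong_0_dvd choose_prime_power_dvd)
      qed (use q0 in \<open>auto simp: binomial_eq_0\<close>)
    qed
    also have "\<dots> = of_nat (?M choose m) + (if ?q \<le> m then of_nat (?M choose (m - ?q)) else 0)"
      by (simp add: sum.distrib)
    finally show ?thesis .
  qed
  show ?case
  proof (cases k)
    case 0
    then show ?thesis using van[of t] Suc[of 0] assms by simp (metis rcong_trans)
  next
    case (Suc k')
    have "(of_nat (?q * Suc n + s choose (?q * k + t)) :: rat)
      \<simeq> of_nat (?M choose (?q * k + t)) + of_nat (?M choose (?q * k' + t))"
      using van[of "?q * k + t"] Suc by simp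
    also have "\<dots> \<simeq> of_nat ((n choose k) * (s choose t)) + of_nat ((n choose k') * (s choose t))"
      by (intro rcong_add Suc.IH)
    finally show ?thesis using Suc by (simp add: algebra_simps)
  qed
qed

lemma inverse_fact_p_minus1: "1 / fact (p - 1) \<simeq> - 1"
proof -
  have "[fact (p - 1) = (-1 :: int)] (mod int p)"
    using wilson_theorem[OF prime_p] by simp
  then have "of_int (fact (p - 1)) \<simeq> of_int (-1)"
    by (rule rcong_of_int)
  then have *: "fact (p - 1) \<simeq> - 1" by simp
  have "pint (1 / fact (p - 1))" using p_gt0 by (intro pint_divide_fact) auto
  from rcong_cmult[OF this *] have "1 \<simeq> - (1 / fact (p - 1))" by simp
  from rcong_minus[OF this] show ?thesis by (simp add: rcong_sym)
qed

text \<open>Wilson's theorem for (p - 1)!, divided by the binomial p - 1 over j, which is congruent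
  to (-1)^j.\<close>

lemma fact_mult_fact:
  assumes "j < p" shows "fact j * fact (p - 1 - j) \<simeq> (- 1) ^ Suc j"
proof -
  have "(fact j * fact (p - 1 - j) * (p - 1 choose j) :: nat) = fact (p - 1)"
    using assms by (intro binomial_fact_lemma) simp
  then have *: "(fact j * fact (p - 1 - j) :: rat) * of_nat (p - 1 choose j) = fact (p - 1)"
    by (metis of_nat_fact of_nat_mult)
  have "[fact (p - 1) = (-1 :: int)] (mod int p)"
    using wilson_theorem[OF prime_p] by simp
  then have w: "fact (p - 1) \<simeq> - 1"
    using rcong_of_int by fastforce
  have c: "of_nat (p - 1 choose j) \<simeq> (-1) ^ j"
    using choose_prime_power_minus1[of j 1] assms by simp
  have "pint (fact j * fact (p - 1 - j))"
    using pint_of_nat[of "fact j * fact (p - 1 - j)"] by simp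
  from rcong_cmult[OF this c] have "(-1) ^ j * (fact j * fact (p - 1 - j)) \<simeq> -1"
    using w * by (metis rcong_sym rcong_trans mult.commute)
  from rcong_cmult[OF _ this, of "(-1)^j"] show ?thesis
    using pint_of_int[of "(-1)^j"] by (simp add: mult.assoc[symmetric] power_mult_distrib[symmetric])
qed

end

section \<open>A recurrence for the Fleck quotients\<close>

text \<open>The value at 0 of the sequence u^n f, where u = 1 - x and x is the shift.\<close>

definition alt_binom_sum :: "nat \<Rightarrow> (nat \<Rightarrow> 'a::comm_ring_1) \<Rightarrow> 'a" where
  "alt_binom_sum n f = (\<Sum>k\<le>n. of_nat (n choose k) * (- 1) ^ k * f k)"

lemma alt_binom_sum_0 [simp]: "alt_binom_sum 0 f = f 0"
  by (simp add: alt_binom_sum_def)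

lemma alt_binom_sum_Suc:
  "alt_binom_sum (Suc n) f = alt_binom_sum n f - alt_binom_sum n (\<lambda>k. f (Suc k))"
proof -
  have "alt_binom_sum (Suc n) f
      = f 0 + (\<Sum>k\<le>n. of_nat (Suc n choose Suc k) * (- 1) ^ Suc k * f (Suc k))"
    unfolding alt_binom_sum_def by (subst sum.atMost_Suc_shift) simp
  also have "\<dots> = (f 0 + (\<Sum>k\<le>n. of_nat (n choose Suc k) * (- 1) ^ Suc k * f (Suc k)))
      - alt_binom_sum n (\<lambda>k. f (Suc k))"
    unfolding alt_binom_sum_def by (simp add: sum_subtractf[symmetric] sum.distrib[symmetric] algebra_simps)
  also have "f 0 + (\<Sum>k\<le>n. of_nat (n choose Suc k) * (- 1) ^ Suc k * f (Suc k))
      = (\<Sum>k\<le>Suc n. of_nat (n choose k) * (- 1) ^ k * f k)"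
    by (subst sum.atMost_Suc_shift) simp
  also have "\<dots> = alt_binom_sum n f"
    unfolding alt_binom_sum_def by (simp add: binomial_eq_0)
  finally show ?thesis .
qed

lemma alt_binom_sum_diff:
  "alt_binom_sum n (\<lambda>k. f k - g k) = alt_binom_sum n f - alt_binom_sum n g"
  by (simp add: alt_binom_sum_def algebra_simps sum_subtractf)

text \<open>With \<open>u = 1 - x\<close> acting on sequences through the shift \<open>x\<close>, this is \<open>(1 - u) ^ m * u ^ n = x ^ m * u ^ n\<close>.\<close>

lemma alt_binom_sum_shift:
  "alt_binom_sum m (\<lambda>j. alt_binom_sum (n + j) f) = alt_binom_sum n (\<lambda>k. f (k + m))"
proof (induction m arbitrary: n)
  case (Suc m)
  have "alt_binom_sum (Suc m) (\<lambda>j. alt_binom_sum (n + j) f)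
      = alt_binom_sum n (\<lambda>k. f (k + m)) - alt_binom_sum (Suc n) (\<lambda>k. f (k + m))"
    using Suc[of n] Suc[of "Suc n"] by (simp add: alt_binom_sum_Suc[of m])
  then show ?case by (simp add: alt_binom_sum_Suc)
qed simp

lemma sum_if_dvd:
  fixes g :: "nat \<Rightarrow> 'a::comm_monoid_add"
  assumes "d > 0"
  shows "(\<Sum>j\<in>{1..<d * m}. if d dvd j then g j else 0) = (\<Sum>i\<in>{1..<m}. g (d * i))"
proof -
  have "(\<Sum>i\<in>{1..<m}. g (d * i)) = sum g ((*) d ` {1..<m})"
    using assms by (subst sum.reindex) (auto simp: inj_on_def)
  also have "(*) d ` {1..<m} = {j \<in> {1..<d * m}. d dvd j}"
    using assms by (auto simp: image_def)
  also have "sum g \<dots> = (\<Sum>j\<in>{1..<d * m}. if d dvd j then g j else 0)"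
    by (subst sum.inter_filter) auto
  finally show ?thesis by simp
qed

locale fleck_setting = prime_modulus +
  fixes a t :: nat and r :: int
  assumes a_pos: "a > 0" and t_less: "t < p ^ (a - 1)"
begin

abbreviation P :: nat where "P \<equiv> p ^ (a - 1)"

text \<open>For \<open>a = 1\<close> this is \<open>1\<close> instead of \<open>1/p\<close>; it is then only used under the unsatisfiable condition
  \<open>s + Q * i < P\<close> with \<open>i > 0\<close>.\<close>

abbreviation Q :: nat where "Q \<equiv> p ^ (a - 2)"

text \<open>Only t and r are fixed in the locale. The digit part s is recovered as
  \<open>N mod P\<close>, because N runs through the recurrence.\<close>

definition \<rho> :: int where "\<rho> = int P * r + int t"

text \<open>The weight is extended by 0 outside the residue class of \<rho>, which turns the Fleck
  sum into an alternating sum over all k and makes the shift calculus applicable.\<close>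

definition residue_binom :: "nat \<Rightarrow> nat \<Rightarrow> rat" where
  "residue_binom l k =
     (if int (p ^ a) dvd int k - \<rho> then of_int ((int k - \<rho>) div int (p ^ a)) gchoose l else 0)"

definition fleck_sum :: "nat \<Rightarrow> nat \<Rightarrow> rat" where
  "fleck_sum l N = alt_binom_sum N (residue_binom l)"

text \<open>The floor in the exponent of -p equals \<open>expo l n - l\<close> with n =
  \<open>N div P\<close>. The same number is the upper argument of the binomial on the Bernoulli
  side.\<close>

definition expo :: "nat \<Rightarrow> nat \<Rightarrow> int" where
  "expo l n = (int n - int l - 1) div (int p - 1)"

definition fleck :: "nat \<Rightarrow> nat \<Rightarrow> rat" where
  "fleck l N = (- of_nat p) powi (int l - expo l (N div P)) * fleck_sum l N"

lemma P_pos: "P > 0" and Q_pos: "Q > 0"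
  using p_gt0 by auto

lemma div_P_add: "(N + P * m) div P = N div P + m"
  using P_pos by (metis add.commute div_mult_self2 less_irrefl)

lemma div_mod_P:
  assumes "x < P" shows "(P * n + x) div P = n" "(P * n + x) mod P = x"
  using div_P_add[of x n] assms by (simp_all add: add.commute)

lemma pa: "p ^ a = P * p"
  using a_pos by (metis mult.commute power_minus_mult)

lemma fleck_quotient_eq: "fleck_quotient p a l N \<rho> = fleck l N"
proof -
  have tot: "totient (p ^ a) = P * (p - 1)"
    using totient_prime_power[OF prime_p a_pos] by simp
  have "(of_nat N - of_nat (l * p ^ a) - of_nat P) / (of_nat (totient (p ^ a)) :: rat)
     = of_int (int N - int l * int (p ^ a) - int P) / of_int (int P * (int p - 1))"
    unfolding tot using p_gt0 by (simp add: of_nat_diff)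
  then have "\<lfloor>(of_nat N - of_nat (l * p ^ a) - of_nat P) / (of_nat (totient (p ^ a)) :: rat)\<rfloor>
     = (int N - int l * int (p ^ a) - int P) div (int P * (int p - 1))"
    by (simp only: floor_divide_of_int_eq)
  \<comment> \<open>Dividing first by P and then by p - 1 shows that the exponent depends on N only
    through \<open>N div P\<close>.\<close>
  also have "\<dots> = ((int N + int P * (- (int l * int p) - 1)) div int P) div (int p - 1)"
    using p_gt1 P_pos by (subst zdiv_zmult2_eq) (auto simp: pa algebra_simps)
  also have "(int N + int P * (- (int l * int p) - 1)) div int P = int (N div P) - int l * int p - 1"
    using P_pos by (subst div_mult_self2) (auto simp: zdiv_int)
  also have "\<dots> = (int (N div P) - int l - 1) + (- int l) * (int p - 1)"
    by (simp add: algebra_simps)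
  also have "\<dots> div (int p - 1) = expo l (N div P) - int l"
    unfolding expo_def using p_gt1 by (subst div_mult_self1) auto
  finally have ex: "\<lfloor>(of_nat N - of_nat (l * p ^ a) - of_nat P) / (of_nat (totient (p ^ a)) :: rat)\<rfloor>
     = expo l (N div P) - int l" .
  have q0: "p ^ a > 0" using p_gt0 by simp
  have "(\<Sum>k | k \<le> N \<and> [int k = \<rho>] (mod int (p ^ a)).
          of_nat (N choose k) * (- 1) ^ k * ((of_int (int k - \<rho>) / of_nat (p ^ a) :: rat) gchoose l))
     = (\<Sum>k | k \<in> {..N} \<and> int (p ^ a) dvd int k - \<rho>. of_nat (N choose k) * (- 1) ^ k * residue_binom l k)"
  proof (rule sum.cong)
    fix k assume "k \<in> {k. k \<in> {..N} \<and> int (p ^ a) dvd int k - \<rho>}"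
    then obtain c where c: "int k - \<rho> = int (p ^ a) * c" by auto
    have "of_int (int k - \<rho>) / of_nat (p ^ a) = (of_int c :: rat)"
      unfolding c using q0 by simp
    moreover have "(int k - \<rho>) div int (p ^ a) = c"
      unfolding c using q0 by simp
    ultimately show "of_nat (N choose k) * (- 1) ^ k * ((of_int (int k - \<rho>) / of_nat (p ^ a) :: rat) gchoose l)
       = of_nat (N choose k) * (- 1) ^ k * residue_binom l k"
      unfolding residue_binom_def using c by simp
  qed (auto simp: cong_iff_dvd_diff)
  also have "\<dots> = fleck_sum l N"
    unfolding fleck_sum_def alt_binom_sum_def
    by (rule sum.mono_neutral_left) (auto simp: residue_binom_def)
  finally show ?thesis
    unfolding fleck_quotient_def fleck_def ex by simp
qed

text \<open>Moving k by \<open>p ^ a\<close> raises the upper argument of the binomial by 1, so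
  Pascal's rule says that x^(p^a) - 1 lowers l by one and annihilates the weight for l = 0.\<close>

lemma residue_binom_shift:
  "residue_binom l (k + p ^ a) - residue_binom l k = (if l = 0 then 0 else residue_binom (l - 1) k)"
proof -
  have q0: "p ^ a > 0" using p_gt0 by simp
  have d: "int (p ^ a) dvd int (k + p ^ a) - \<rho> \<longleftrightarrow> int (p ^ a) dvd int k - \<rho>"
    by (metis add_diff_eq add.commute dvd_add_triv_left_iff of_nat_add)
  show ?thesis
  proof (cases "int (p ^ a) dvd int k - \<rho>")
    case True
    then obtain c where c: "int k - \<rho> = int (p ^ a) * c" by auto
    have "int (k + p ^ a) - \<rho> = int (p ^ a) * (c + 1)"
      using c by (simp add: algebra_simps)
    then have "(int (k + p ^ a) - \<rho>) div int (p ^ a) = c + 1" "(int k - \<rho>) div int (p ^ a) = c"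
      unfolding c using q0 by simp_all
    then show ?thesis
      unfolding residue_binom_def using True d
      by (cases l) (simp_all add: gbinomial_Suc_Suc)
  next
    case False
    then show ?thesis unfolding residue_binom_def using d by simp
  qed
qed

text \<open>The operator x^(p^a) is expanded as (1 - u)^(p^a) by \<open>alt_binom_sum_shift\<close>.
  The term j = 0 cancels against the unshifted sum and the term j = \<open>p ^ a\<close> is
  isolated.\<close>

lemma fleck_sum_rec:
  "(- 1) ^ (p ^ a) * fleck_sum l (N + p ^ a)
     = (if l = 0 then 0 else fleck_sum (l - 1) N)
       - (\<Sum>j\<in>{1..<p ^ a}. of_nat (p ^ a choose j) * (- 1) ^ j * fleck_sum l (N + j))"
proof -
  let ?f = "\<lambda>j. of_nat (p ^ a choose j) * (- 1) ^ j * fleck_sum l (N + j)"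
  have q0: "p ^ a > 0" using p_gt0 by simp
  have "sum ?f {..p ^ a} = alt_binom_sum N (\<lambda>k. residue_binom l (k + p ^ a))"
    using alt_binom_sum_shift[of "p ^ a" N "residue_binom l"]
    by (simp add: alt_binom_sum_def[of "p ^ a"] fleck_sum_def)
  also have "\<dots> = fleck_sum l N + alt_binom_sum N (\<lambda>k. residue_binom l (k + p ^ a) - residue_binom l k)"
    by (simp add: alt_binom_sum_diff fleck_sum_def)
  also have "alt_binom_sum N (\<lambda>k. residue_binom l (k + p ^ a) - residue_binom l k)
     = (if l = 0 then 0 else fleck_sum (l - 1) N)"
    unfolding residue_binom_shift by (simp add: fleck_sum_def alt_binom_sum_def)
  finally have 1: "sum ?f {..p ^ a} = fleck_sum l N + (if l = 0 then 0 else fleck_sum (l - 1) N)" .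
  have "{..p ^ a} = insert 0 (insert (p ^ a) {1..<p ^ a})" using q0 by auto
  then have "sum ?f {..p ^ a} = ?f 0 + (?f (p ^ a) + sum ?f {1..<p ^ a})"
    using q0 by (simp only:) (subst sum.insert; simp)+
  with 1 show ?thesis by simp
qed

section \<open>Growth and jumps of the exponent\<close>

lemma expo_mono: "n \<le> n' \<Longrightarrow> expo l n \<le> expo l n'"
  unfolding expo_def using p_gt1 by (intro zdiv_mono1) auto

lemma expo_add: "expo l (n + (p - 1)) = expo l n + 1"
proof -
  have "int (n + (p - 1)) - int l - 1 = (int n - int l - 1) + (int p - 1)"
    using p_gt0 by simp
  moreover have "(int n - int l - 1 + (int p - 1)) div (int p - 1) = (int n - int l - 1) div (int p - 1) + 1"
    using p_gt1 by (intro div_add_self2) simp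
  ultimately show ?thesis unfolding expo_def by simp
qed

lemma expo_Suc: "expo l (Suc n) = (if (int p - 1) dvd (int n - int l) then expo l n + 1 else expo l n)"
proof -
  have "int (Suc n) - int l - 1 = int n - int l" by simp
  \<comment> \<open>A floor of x / d rises between x - 1 and x exactly when d divides x.\<close>
  moreover have "x div d = (if d dvd x then (x - 1) div d + 1 else (x - 1) div d)" if "d > 0" for x d :: int
  proof (cases "d dvd x")
    case True
    then obtain c where "x = d * c" by auto
    moreover have "(d * c - 1) div d = c - 1"
    proof -
      have "d * c - 1 = (d - 1) + d * (c - 1)" by (simp add: algebra_simps)
      moreover have "((d - 1) + d * (c - 1)) div d = (c - 1) + (d - 1) div d"
        using that by (intro div_mult_self2) simp
      moreover have "(d - 1) div d = 0" using that by (intro div_pos_pos_trivial) auto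
      ultimately show ?thesis by (simp only:)
    qed
    ultimately show ?thesis using that by simp
  next
    case False
    then have "x mod d \<noteq> 0" by (simp add: dvd_eq_mod_eq_0)
    then have "x mod d \<ge> 1" using pos_mod_sign[OF that, of x] by linarith
    then have "(x mod d - 1) div d = 0"
      using pos_mod_bound[OF that, of x] by (intro div_pos_pos_trivial) linarith+
    moreover have "((x mod d - 1) + d * (x div d)) div d = x div d + (x mod d - 1) div d"
      using that by (intro div_mult_self2) simp
    moreover have "(x mod d - 1) + d * (x div d) = x - 1" by (simp add: algebra_simps)
    ultimately have "(x - 1) div d = x div d" by simp
    then show ?thesis using False by simp
  qed
  ultimately show ?thesis unfolding expo_def using p_gt1 by simp
qed

text \<open>A step by p is a step by p - 1, which always adds 1, and a step by 1, which adds another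
  1 exactly when p - 1 divides n - l. This double jump is the source of the exceptional
  case.\<close>

lemma expo_add_p: "expo l (n + p) = (if (int p - 1) dvd (int n - int l) then expo l n + 2 else expo l n + 1)"
proof -
  have "n + p = Suc n + (p - 1)" using p_gt0 by simp
  then show ?thesis using expo_add[of l "Suc n"] expo_Suc[of l n] by simp
qed

lemma expo_pred: "l > 0 \<Longrightarrow> expo (l - 1) n = expo l (n + p) - 1"
proof -
  assume "l > 0"
  then have "expo (l - 1) n = expo l (Suc n)" unfolding expo_def by (simp add: of_nat_diff)
  moreover have "n + p = Suc n + (p - 1)" using p_gt0 by simp
  ultimately show ?thesis using expo_add[of l "Suc n"] by simp
qed

section \<open>Reduction of the normalised recurrence modulo p\<close>

lemma fleck_sum_eq: "fleck_sum l N = (- of_nat p) powi (expo l (N div P) - int l) * fleck l N"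
proof -
  have "(- of_nat p :: rat) powi (expo l (N div P) - int l) * (- of_nat p) powi (int l - expo l (N div P)) = 1"
    using p_gt0 by (subst power_int_add[symmetric]) auto
  then show ?thesis unfolding fleck_def by (simp add: mult.assoc[symmetric])
qed

text \<open>By absorption the binomial is (\<open>p ^ a\<close> / j) times one whose sign-corrected
  value w is congruent to -1, so its p-adic valuation is exactly a - b. Dividing by (-p)^d leaves a
  factor p^(a - b - d), and the term survives only if d = a - b.\<close>

lemma choose_prime_power_term:
  assumes j: "j = p ^ b * i" and i: "\<not> p dvd i" and b: "b < a" and d: "d \<le> a - b"
    and x: "pint x" and jq: "j < p ^ a"
  shows "of_nat (p ^ a choose j) * (- 1) ^ j * (- of_nat p) powi (- int d) * x
      \<simeq> (if d = a - b then - ((- 1) ^ d * (x / of_nat i)) else 0)"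
proof -
  have i0: "i \<noteq> 0" using i by (intro notI) simp
  have j0: "j > 0" using i0 j p_gt0 by simp
  define w :: rat where "w = (-1) ^ j * of_nat (p ^ a - 1 choose (j - 1))"
  have sgn: "pint ((-1) ^ k)" for k using pint_of_int[of "(-1) ^ k"] by simp
  have "w \<simeq> (-1) ^ j * (-1) ^ (j - 1)"
    unfolding w_def using jq j0 by (intro rcong_cmult sgn choose_prime_power_minus1) simp
  also have "(-1) ^ j * (-1) ^ (j - 1) = (-1 :: rat)"
    using j0 by (cases j) (simp_all add: power_mult_distrib[symmetric])
  finally have w: "w \<simeq> -1" .
  have "j * (p ^ a choose j) = p ^ a * (p ^ a - 1 choose (j - 1))"
    using times_binomial_minus1_eq[OF j0] .
  then have "(of_nat j * of_nat (p ^ a choose j) :: rat) = of_nat (p ^ a) * of_nat (p ^ a - 1 choose (j - 1))"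
    by (metis of_nat_mult)
  then have *: "of_nat (p ^ a choose j) * (-1) ^ j = of_nat (p ^ a) / of_nat j * w"
    unfolding w_def using j0 by (simp add: field_simps)
  have "p ^ a = p ^ b * p ^ d * p ^ (a - b - d)"
    using b d by (simp add: power_add[symmetric])
  then have "of_nat (p ^ a) / of_nat j = (of_nat p ^ d * of_nat p ^ (a - b - d) / of_nat i :: rat)"
    unfolding j using p_gt0 by (simp add: power_add)
  moreover have "(- of_nat p :: rat) powi (- int d) = (-1) ^ d / of_nat p ^ d"
  proof -
    have "(- of_nat p :: rat) powi (- int d) = inverse ((- of_nat p) ^ d)"
      by (simp add: power_int_minus)
    also have "(- of_nat p :: rat) ^ d = (-1) ^ d * of_nat p ^ d"
      by (rule power_minus)
    also have "inverse ((-1) ^ d * of_nat p ^ d :: rat) = (-1) ^ d / of_nat p ^ d"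
      by (cases "even d") (simp_all add: field_simps)
    finally show ?thesis .
  qed
  ultimately have eq: "of_nat (p ^ a choose j) * (- 1) ^ j * (- of_nat p) powi (- int d) * x
     = of_nat p ^ (a - b - d) * (w * ((-1) ^ d * (x / of_nat i)))"
    unfolding * using p_gt0 by simp
  have y: "pint ((-1) ^ d * (x / of_nat i))"
    using sgn x i by (intro pint_mult pint_divide)
  have wi: "pint w" using rcong_pint[OF w] pint_of_int[of "-1"] by simp
  show ?thesis
  proof (cases "d = a - b")
    case True
    have "w * ((-1) ^ d * (x / of_nat i)) \<simeq> - 1 * ((-1) ^ d * (x / of_nat i))"
      by (rule rcong_mult[OF w rcong_refl wi y])
    then show ?thesis unfolding eq using True by simp
  next
    case False
    then have "of_nat p ^ (a - b - d) * (w * ((-1) ^ d * (x / of_nat i))) \<simeq> 0"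
      using d by (intro rcong_0_power pint_mult[OF wi y]) simp
    then show ?thesis unfolding eq using False by simp
  qed
qed

text \<open>Let b be the p-adic valuation of j and d the amount by which the exponent at N + j falls
  short of the one at N + \<open>p ^ a\<close>. A term survives iff d = a - b. If N + j has left the
  block of N, then d is at most 1, which forces b = a - 1 and d = 1. Inside the block j < P, hence b
  is at most a - 2, and only a double jump d = 2 with b = a - 2 survives.\<close>

lemma fleck_rec_term:
  assumes j: "0 < j" "j < p ^ a" and x: "pint (fleck l (N + j))"
  defines "n \<equiv> N div P"
  shows "of_nat (p ^ a choose j) * (- 1) ^ j * (- of_nat p) powi (int l - expo l (n + p)) * fleck_sum l (N + j)
    \<simeq> (if P dvd j then if expo l (n + j div P) = expo l (n + p) - 1 then fleck l (N + j) / of_nat (j div P) else 0 else 0)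
    - (if Q dvd j then if (int p - 1) dvd (int n - int l) \<and> N mod P + j < P
        then fleck l (N + j) / of_nat (j div Q) else 0 else 0)"
proof -
  have "j \<noteq> 0" "\<not> is_unit p" using j p_gt1 by auto
  then obtain i where i: "j = p ^ multiplicity p j * i" "\<not> p dvd i"
    using multiplicity_decompose' by blast
  define b where "b = multiplicity p j"
  have ji: "j = p ^ b * i" using i b_def by simp
  have i0: "i \<noteq> 0" using i(2) by (intro notI) simp
  have "p ^ b \<le> j" using ji i0 by simp
  then have "p ^ b < p ^ a" using j by linarith
  then have ba: "b < a" using p_gt1 by simp
  have dvd_iff: "p ^ c dvd j \<longleftrightarrow> c \<le> b" for c
    unfolding b_def using \<open>j \<noteq> 0\<close> \<open>\<not> is_unit p\<close> by (simp add: power_dvd_iff_le_multiplicity)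
  define n' where "n' = (N + j) div P"
  have n': "n \<le> n'" unfolding n_def n'_def by (simp add: div_le_mono)
  have "(N + j) div P \<le> (N + P * p) div P"
    using j pa by (intro div_le_mono) simp
  then have n'p: "n' \<le> n + p" unfolding n_def n'_def div_P_add .
  have small: "n' = n \<longleftrightarrow> N mod P + j < P"
  proof -
    have "N + j = P * n + (N mod P + j)" unfolding n_def by simp
    then have "n' = n + (N mod P + j) div P" unfolding n'_def using P_pos by (metis div_mult_self4 less_irrefl)
    then show ?thesis using p_gt0 by (simp add: div_eq_0_iff)
  qed
  have Pj: "(N + j) div P = n + j div P" if "P dvd j"
    using that P_pos unfolding n_def by (auto simp: div_mult_self2)
  let ?exc = "(int p - 1) dvd (int n - int l)"
  define d where "d = nat (expo l (n + p) - expo l n')"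
  have Ele: "expo l n' \<le> expo l (n + p)" using n'p by (rule expo_mono)
  have dE: "expo l n' = expo l (n + p) - int d" unfolding d_def using Ele by simp
  \<comment> \<open>Leaving the block means n' is at least n + 1, and from n + 1 to n + p the
    exponent grows by exactly 1.\<close>
  have d1: "d \<le> 1" if "n' \<noteq> n"
  proof -
    have "Suc n \<le> n'" using that n' by simp
    then have "expo l (Suc n) \<le> expo l n'" by (rule expo_mono)
    moreover have "expo l (n + p) = expo l (Suc n) + 1"
      using expo_add[of l "Suc n"] p_gt0 by simp
    ultimately show ?thesis using dE by simp
  qed
  have d2: "d = (if ?exc then 2 else 1)" if "n' = n"
    using dE that expo_add_p[of l n] by (auto split: if_splits)
  have eqE: "(- of_nat p :: rat) powi (int l - expo l (n + p)) * fleck_sum l (N + j)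
     = (- of_nat p) powi (- int d) * fleck l (N + j)"
  proof -
    have "(- of_nat p :: rat) powi (int l - expo l (n + p)) * (- of_nat p) powi (expo l n' - int l)
       = (- of_nat p) powi (- int d)"
      using p_gt0 dE by (subst power_int_add[symmetric]) auto
    then show ?thesis unfolding fleck_sum_eq n'_def by (simp add: mult.assoc[symmetric])
  qed
  have bs: "b < a - 1" if "n' = n"
  proof -
    have "j < P" using that small by simp
    then have "p ^ b < P" using \<open>p ^ b \<le> j\<close> by linarith
    then show ?thesis using p_gt1 by simp
  qed
  have dab: "d \<le> a - b"
    using d1 d2 bs ba by (cases "n' = n") (auto split: if_splits)
  have main: "of_nat (p ^ a choose j) * (- 1) ^ j * (- of_nat p) powi (int l - expo l (n + p)) * fleck_sum l (N + j)
    \<simeq> (if d = a - b then - ((- 1) ^ d * (fleck l (N + j) / of_nat i)) else 0)" (is "?L \<simeq> _")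
    using choose_prime_power_term[OF ji i(2) ba dab x j(2)] unfolding mult.assoc eqE .
  show ?thesis
  proof (cases "n' = n")
    case True
    then have "\<not> P dvd j" using bs dvd_iff by auto
    moreover have "Q dvd j \<longleftrightarrow> b = a - 2" using dvd_iff bs[OF True] by auto
    moreover have "j div Q = i" if "b = a - 2" using that ji Q_pos by simp
    moreover have "d = a - b \<longleftrightarrow> ?exc \<and> b = a - 2" using d2[OF True] bs[OF True] by auto
    ultimately show ?thesis using main True small d2[OF True] by auto
  next
    case False
    have eq: "d = a - b \<longleftrightarrow> d = 1 \<and> b = a - 1" using d1[OF False] ba by auto
    have Pb: "P dvd j \<longleftrightarrow> b = a - 1" using dvd_iff ba by auto
    have "j div P = i" if "b = a - 1" using that ji P_pos by simp
    moreover have "expo l (n + j div P) = expo l (n + p) - 1 \<longleftrightarrow> d = 1" if "P dvd j"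
      using Pj[OF that] dE unfolding n'_def by auto
    ultimately show ?thesis using main False small eq Pb by auto
  qed
qed

lemma fleck_rec:
  assumes int: "\<And>j. 0 < j \<Longrightarrow> j < p ^ a \<Longrightarrow> pint (fleck l (N + j))"
  defines "n \<equiv> N div P"
  shows "(- 1) ^ (p ^ a) * fleck l (N + p ^ a)
    \<simeq> (if l = 0 then 0 else fleck (l - 1) N)
     - (\<Sum>i\<in>{1..<p}. if expo l (n + i) = expo l (n + p) - 1 then fleck l (N + P * i) / of_nat i else 0)
     + (if (int p - 1) dvd (int n - int l)
        then \<Sum>i\<in>{1..<p}. if N mod P + Q * i < P then fleck l (N + Q * i) / of_nat i else 0 else 0)"
proof -
  let ?e = "(- of_nat p :: rat) powi (int l - expo l (n + p))"
  let ?exc = "(int p - 1) dvd (int n - int l)"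
  let ?f = "\<lambda>j. if expo l (n + j div P) = expo l (n + p) - 1 then fleck l (N + j) / of_nat (j div P) else 0"
  let ?g = "\<lambda>j. if ?exc \<and> N mod P + j < P then fleck l (N + j) / of_nat (j div Q) else 0"
  have np: "(N + p ^ a) div P = n + p"
    unfolding pa n_def by (rule div_P_add)
  have "(- 1) ^ (p ^ a) * fleck l (N + p ^ a) = ?e * ((-1) ^ (p ^ a) * fleck_sum l (N + p ^ a))"
    unfolding fleck_def np by simp
  also have "\<dots> = (if l = 0 then 0 else ?e * fleck_sum (l - 1) N)
      - (\<Sum>j\<in>{1..<p ^ a}. of_nat (p ^ a choose j) * (- 1) ^ j * ?e * fleck_sum l (N + j))"
    unfolding fleck_sum_rec by (simp add: right_diff_distrib sum_distrib_left mult_ac)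
  \<comment> \<open>Passing from l to l - 1 lowers both l and the exponent by one, so the power of
    -p belonging to (l, n + p) is the one belonging to (l - 1, n).\<close>
  also have "(if l = 0 then 0 else ?e * fleck_sum (l - 1) N) = (if l = 0 then 0 else fleck (l - 1) N)"
    using expo_pred[of l n] unfolding fleck_def n_def by (simp add: of_nat_diff algebra_simps)
  also have "(if l = 0 then 0 else fleck (l - 1) N)
      - (\<Sum>j\<in>{1..<p ^ a}. of_nat (p ^ a choose j) * (- 1) ^ j * ?e * fleck_sum l (N + j))
     \<simeq> (if l = 0 then 0 else fleck (l - 1) N)
      - (\<Sum>j\<in>{1..<p ^ a}. (if P dvd j then ?f j else 0) - (if Q dvd j then ?g j else 0))"
    unfolding n_def by (intro rcong_diff rcong_refl rcong_sum fleck_rec_term int) auto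
  also have "(\<Sum>j\<in>{1..<p ^ a}. (if P dvd j then ?f j else 0) - (if Q dvd j then ?g j else 0))
     = (\<Sum>j\<in>{1..<P * p}. (if P dvd j then ?f j else 0)) - (\<Sum>j\<in>{1..<P * p}. (if Q dvd j then ?g j else 0))"
    unfolding pa by (rule sum_subtractf)
  also have "(\<Sum>j\<in>{1..<P * p}. (if P dvd j then ?f j else 0)) = (\<Sum>i\<in>{1..<p}. ?f (P * i))"
    using P_pos by (rule sum_if_dvd)
  also have "(\<Sum>i\<in>{1..<p}. ?f (P * i))
     = (\<Sum>i\<in>{1..<p}. if expo l (n + i) = expo l (n + p) - 1 then fleck l (N + P * i) / of_nat i else 0)"
    using P_pos by (intro sum.cong) auto
  \<comment> \<open>The condition \<open>N mod P + j < P\<close> already excludes every j that is at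
    least P.\<close>
  also have "(\<Sum>j\<in>{1..<P * p}. (if Q dvd j then ?g j else 0)) = (\<Sum>j\<in>{1..<P}. (if Q dvd j then ?g j else 0))"
    using p_gt0 by (intro sum.mono_neutral_right) auto
  also have "\<dots> = (if ?exc then \<Sum>i\<in>{1..<p}. if N mod P + Q * i < P then fleck l (N + Q * i) / of_nat i else 0 else 0)"
  \<comment> \<open>For a = 1 we have P = 1 and no positive j fits. Otherwise P = Q * p and the
    multiples of Q below P are Q * i with i < p.\<close>
  proof (cases "a = 1")
    case True
    then show ?thesis by (auto intro!: sum.neutral)
  next
    case False
    then have "a - 1 = Suc (a - 2)" using a_pos by simp
    then have PQ: "P = Q * p" by simp
    have "(\<Sum>j\<in>{1..<P}. (if Q dvd j then ?g j else 0)) = (\<Sum>i\<in>{1..<p}. ?g (Q * i))"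
      unfolding PQ using Q_pos by (rule sum_if_dvd)
    then show ?thesis using Q_pos by (auto intro!: sum.cong)
  qed
  finally show ?thesis by (simp add: algebra_simps)
qed

end

section \<open>Power series coefficients of order \<open>-n\<close>\<close>

text \<open>The series (e^x - 1) / x, given by its coefficients so that no division of series is
  involved.\<close>

definition exp_quot :: "rat fps" where
  "exp_quot = Abs_fps (\<lambda>i. 1 / fact (Suc i))"

lemma X_mult_exp_quot: "fps_X * exp_quot = fps_exp 1 - 1"
proof (rule fps_ext)
  show "fps_nth (fps_X * exp_quot) n = fps_nth (fps_exp 1 - 1) n" for n
    by (cases n) (simp_all add: exp_quot_def algebra_simps)
qed

lemma exp_quot_power: "(1 - fps_exp 1) ^ i = fps_const ((- 1) ^ i) * (fps_X ^ i * exp_quot ^ i)"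
proof -
  have "1 - fps_exp 1 = fps_const (-1) * (fps_X * exp_quot)"
    unfolding X_mult_exp_quot by (simp add: fps_const_neg[symmetric])
  then have "(1 - fps_exp 1) ^ i = fps_const (-1) ^ i * (fps_X * exp_quot) ^ i"
    by (simp only: power_mult_distrib)
  then show ?thesis by (simp add: power_mult_distrib fps_const_power)
qed

text \<open>The partial sums of \<open>- log (1 - V)\<close> at \<open>V = 1 - exp x\<close> approximate \<open>- x\<close>.\<close>

lemma log_partial_sum_nth:
  assumes "k \<le> J"
  shows "fps_nth ((\<Sum>i\<in>{1..J}. fps_const (1 / of_nat i) * (1 - fps_exp 1 :: rat fps) ^ i) + fps_X) k = 0"
    (is "fps_nth (?L + _) k = 0")
proof -
  define V where "V = (1 - fps_exp 1 :: rat fps)"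
  have V0: "fps_nth V 0 = 0" by (simp add: V_def)
  have dV: "fps_deriv V = - (1 - V)" by (simp add: V_def)
  \<comment> \<open>Differentiation turns the logarithm into a geometric sum: since V' = -(1 - V),
    the derivative of the whole expression telescopes to V^J, which vanishes in degrees below
    J.\<close>
  have "fps_deriv ?L = (\<Sum>i\<in>{1..J}. fps_deriv V * V ^ (i - 1))"
    unfolding V_def[symmetric] fps_deriv_sum
  proof (rule sum.cong)
    fix i assume "i \<in> {1..J}"
    then have "of_nat i \<noteq> (0::rat)" by simp
    then show "fps_deriv (fps_const (1 / of_nat i) * V ^ i) = fps_deriv V * V ^ (i - 1)"
      by (simp add: fps_deriv_power' fps_of_nat[symmetric] mult.assoc[symmetric])
  qed simp
  also have "\<dots> = - ((1 - V) * (\<Sum>i\<in>{1..J}. V ^ (i - 1)))"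
    unfolding dV by (simp only: mult_minus_left sum_negf sum_distrib_left)
  also have "(\<Sum>i\<in>{1..J}. V ^ (i - 1)) = (\<Sum>i<J. V ^ i)"
    by (rule sum.reindex_bij_witness[of _ Suc "\<lambda>i. i - 1"]) auto
  also have "(1 - V) * \<dots> = 1 - V ^ J" by (rule one_diff_power_eq[symmetric])
  finally have d: "fps_deriv (?L + fps_X) = V ^ J" by simp
  show ?thesis
  proof (cases k)
    case 0
    then show ?thesis by (simp add: fps_sum_nth fps_power_zeroth power_0_left)
  next
    case (Suc k')
    have "of_nat (Suc k') * fps_nth (?L + fps_X) (Suc k') = fps_nth (V ^ J) k'"
      unfolding d[symmetric] by (simp only: fps_deriv_nth Suc_eq_plus1)
    also have "\<dots> = 0" using startsby_zero_power_prefix[OF V0, of J] assms Suc by simp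
    finally show ?thesis unfolding Suc by (simp only: mult_eq_0_iff of_nat_eq_0_iff) simp
  qed
qed

text \<open>The coefficients of the right side are alternating sums of powers of k + c, a form in
  which Fermat's theorem can be applied.\<close>

lemma one_minus_exp_power_mult:
  "(1 - fps_exp 1) ^ n * fps_exp c
     = (\<Sum>k\<le>n. fps_const (of_nat (n choose k) * (- 1) ^ k) * fps_exp (of_nat k + c) :: rat fps)"
proof -
  have "(1 - fps_exp 1 :: rat fps) ^ n = (- fps_exp 1 + 1) ^ n" by simp
  also have "\<dots> = (\<Sum>k\<le>n. of_nat (n choose k) * (- fps_exp 1) ^ k * 1 ^ (n - k))"
    by (rule binomial_ring)
  also have "\<dots> * fps_exp c
      = (\<Sum>k\<le>n. of_nat (n choose k) * (- fps_exp 1) ^ k * 1 ^ (n - k) * fps_exp c)"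
    by (rule sum_distrib_right)
  also have "\<dots> = (\<Sum>k\<le>n. fps_const (of_nat (n choose k) * (- 1) ^ k) * fps_exp (of_nat k + c))"
  proof (rule sum.cong)
    fix k
    have "(- fps_exp 1 :: rat fps) ^ k = (-1) ^ k * fps_exp 1 ^ k" by (rule power_minus)
    also have "(-1 :: rat fps) ^ k = fps_const ((-1) ^ k)"
      by (cases "even k") (simp_all add: fps_const_neg[symmetric])
    also have "fps_exp (1 :: rat) ^ k = fps_exp (of_nat k)" by (simp add: fps_exp_power_mult)
    finally have "of_nat (n choose k) * (- fps_exp 1 :: rat fps) ^ k * 1 ^ (n - k) * fps_exp c
        = fps_const (of_nat (n choose k)) * fps_const ((-1) ^ k) * (fps_exp (of_nat k) * fps_exp c)"
      unfolding fps_of_nat by (simp only: power_one mult_1_right mult.assoc)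
    also have "fps_exp (of_nat k) * fps_exp c = fps_exp (of_nat k + c)"
      by (rule fps_exp_add_mult[symmetric])
    finally show "of_nat (n choose k) * (- fps_exp 1 :: rat fps) ^ k * 1 ^ (n - k) * fps_exp c
        = fps_const (of_nat (n choose k) * (- 1) ^ k) * fps_exp (of_nat k + c)"
      by (simp only: fps_const_mult)
  qed simp
  finally show ?thesis .
qed

context prime_modulus
begin

text \<open>Formally this is the Bernoulli polynomial of order -n and degree k at -r, divided by
  k!.\<close>

definition quot_coeff :: "int \<Rightarrow> nat \<Rightarrow> nat \<Rightarrow> rat" where
  "quot_coeff r n k = fps_nth (exp_quot ^ n * fps_exp (- of_int r)) k"

lemma quot_coeff_0 [simp]: "quot_coeff r n 0 = 1"
  by (simp add: quot_coeff_def exp_quot_def fps_power_zeroth)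

lemma pint_fps_mult_nth:
  assumes "\<And>i. i \<le> k \<Longrightarrow> pint (fps_nth f i)" "\<And>i. i \<le> k \<Longrightarrow> pint (fps_nth g i)"
  shows "pint (fps_nth (f * g) k)"
  unfolding fps_mult_nth using assms by (intro pint_sum pint_mult) auto

lemma pint_fps_power_nth:
  assumes "\<And>i. i \<le> k \<Longrightarrow> pint (fps_nth f i)" "j \<le> k"
  shows "pint (fps_nth (f ^ n) j)"
  using assms(2)
proof (induction n arbitrary: j)
  case (Suc n)
  then show ?case unfolding power_Suc using assms(1) by (intro pint_fps_mult_nth) auto
qed simp

text \<open>The denominator is (k + 1)!, which is prime to p as long as k + 1 < p. Hence all later
  congruences are confined to degrees below p - 1.\<close>

lemma pint_exp_quot: "k < p - 1 \<Longrightarrow> pint (fps_nth exp_quot k)"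
  unfolding exp_quot_def using pint_divide_fact[of "Suc k" 1] by simp

lemma pint_fps_exp: "k < p - 1 \<Longrightarrow> pint (fps_nth (fps_exp (of_int x)) k)"
  using pint_divide_fact[of k "of_int x ^ k"] by (simp add: pint_power)

lemma pint_quot_coeff: "k < p - 1 \<Longrightarrow> pint (quot_coeff r n k)"
  unfolding quot_coeff_def using pint_fps_exp[of _ "- r"]
  by (intro pint_fps_mult_nth pint_fps_power_nth[of k] pint_exp_quot) auto

text \<open>Frobenius: with W = \<open>exp_quot - 1\<close>, the inner binomials of (1 + W)^p are
  divisible by p, and W^p starts in degree p because W has no constant term.\<close>

lemma exp_quot_power_p:
  assumes "k < p - 1"
  shows "fps_nth (exp_quot ^ p) k \<simeq> (if k = 0 then 1 else 0)"
proof -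
  define W where "W = exp_quot - 1"
  have W0: "fps_nth W 0 = 0" by (simp add: W_def exp_quot_def)
  have Wi: "pint (fps_nth W i)" if "i \<le> k" for i
    using that assms by (auto simp: W_def intro!: pint_diff pint_exp_quot)
  have "exp_quot ^ p = (W + 1) ^ p" by (simp add: W_def)
  also have "\<dots> = (\<Sum>j\<le>p. of_nat (p choose j) * W ^ j)"
    by (subst binomial_ring) simp
  also have "fps_nth \<dots> k = (\<Sum>j\<le>p. of_nat (p choose j) * fps_nth (W ^ j) k)"
    by (simp add: fps_sum_nth fps_of_nat[symmetric])
  also have "\<dots> \<simeq> (\<Sum>j\<le>p. if j = 0 then if k = 0 then 1 else 0 else 0)"
  proof (rule rcong_sum)
    fix j assume "j \<in> {..p}"
    then consider "j = 0" | "0 < j" "j < p" | "j = p" "j > 0" by force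
    then show "of_nat (p choose j) * fps_nth (W ^ j) k \<simeq> (if j = 0 then if k = 0 then 1 else 0 else 0)"
    proof cases
      case 2
      then show ?thesis
        using choose_prime_power_dvd[of j 1] pint_fps_power_nth[of k W, OF Wi]
        by (auto intro!: rcong_0_mult(1) rcong_0_dvd)
    next
      case 3
      then show ?thesis using startsby_zero_power_prefix[OF W0, of p] assms by simp
    qed simp
  qed
  finally show ?thesis by simp
qed

lemma exp_quot_power_p_mult:
  assumes "k < p - 1"
  shows "fps_nth (exp_quot ^ (p * z)) k \<simeq> (if k = 0 then 1 else 0)"
  using assms
proof (induction z arbitrary: k)
  case (Suc z)
  have "fps_nth (exp_quot ^ (p * Suc z)) k
      = (\<Sum>i=0..k. fps_nth (exp_quot ^ p) i * fps_nth (exp_quot ^ (p * z)) (k - i))"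
    by (simp add: power_add fps_mult_nth)
  also have "\<dots> \<simeq> (\<Sum>i=0..k. (if i = 0 then 1 else 0) * (if k - i = 0 then 1 else 0))"
    using Suc.prems
    by (intro rcong_sum rcong_mult exp_quot_power_p Suc.IH pint_fps_power_nth[of k] pint_exp_quot) auto
  also have "\<dots> = (\<Sum>i=0..k. if i = 0 then if k = 0 then 1 else 0 else 0)"
    by (intro sum.cong) auto
  finally show ?case by simp
qed simp

lemma quot_coeff_add_p:
  assumes "k < p - 1"
  shows "quot_coeff r (n + p) k \<simeq> quot_coeff r n k"
proof -
  let ?A = "exp_quot ^ n * fps_exp (- of_int r)"
  have pA: "pint (fps_nth ?A i)" if "i \<le> k" for i
    using that assms pint_quot_coeff[of i r n] by (simp add: quot_coeff_def)
  have "quot_coeff r (n + p) k = (\<Sum>i=0..k. fps_nth (exp_quot ^ p) i * fps_nth ?A (k - i))"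
    unfolding quot_coeff_def fps_mult_nth[symmetric] by (simp add: power_add mult_ac)
  also have "\<dots> \<simeq> (\<Sum>i=0..k. (if i = 0 then 1 else 0) * fps_nth ?A (k - i))"
    using assms exp_quot_power_p pA
    by (intro rcong_sum rcong_mult pint_fps_power_nth[of k] pint_exp_quot rcong_refl) auto
  also have "\<dots> = (\<Sum>i=0..k. if i = 0 then fps_nth ?A k else 0)"
    by (intro sum.cong) auto
  finally show ?thesis by (simp add: quot_coeff_def)
qed

text \<open>The logarithm identity is multiplied by \<open>exp_quot ^ n * fps_exp (- r)\<close> and
  read in degree k + 1. A factor (1 - e^x)^i equals (-1)^i x^i times \<open>exp_quot ^ i\<close>, so
  it lowers the degree by i and raises the order by i.\<close>

lemma quot_coeff_log:
  "(\<Sum>i\<in>{1..Suc k}. (- 1) ^ i * quot_coeff r (n + i) (Suc k - i) / of_nat i) = - quot_coeff r n k"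
proof -
  let ?A = "exp_quot ^ n * fps_exp (- of_int r)"
  let ?L = "\<Sum>i\<in>{1..Suc k}. fps_const (1 / of_nat i) * (1 - fps_exp 1 :: rat fps) ^ i"
  have "fps_nth ((?L + fps_X) * ?A) (Suc k) = 0"
    unfolding fps_mult_nth using log_partial_sum_nth[of _ "Suc k"]
    by (intro sum.neutral) auto
  then have "fps_nth (?L * ?A) (Suc k) + fps_nth (fps_X * ?A) (Suc k) = 0"
    by (simp only: distrib_right fps_add_nth)
  moreover have "fps_nth (fps_X * ?A) (Suc k) = quot_coeff r n k"
    by (simp add: quot_coeff_def)
  moreover have "fps_nth (?L * ?A) (Suc k)
      = (\<Sum>i\<in>{1..Suc k}. fps_nth (fps_const (1 / of_nat i) * (1 - fps_exp 1) ^ i * ?A) (Suc k))"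
    by (simp only: sum_distrib_right fps_sum_nth)
  moreover have "fps_nth (fps_const (1 / of_nat i) * (1 - fps_exp 1) ^ i * ?A) (Suc k)
      = (- 1) ^ i * quot_coeff r (n + i) (Suc k - i) / of_nat i" if "i \<in> {1..Suc k}" for i
  proof -
    have "fps_const (1 / of_nat i) * (1 - fps_exp 1) ^ i * ?A
       = fps_const ((-1) ^ i / of_nat i) * (fps_X ^ i * (exp_quot ^ (n + i) * fps_exp (- of_int r)))"
      unfolding exp_quot_power by (simp add: power_add mult_ac flip: fps_const_mult)
    then show ?thesis using that
      by (simp only: fps_mult_left_const_nth fps_X_power_mult_nth quot_coeff_def) simp
  qed
  ultimately show ?thesis by simp
qed

end

context fleck_setting
begin

text \<open>Unlike \<open>gchoose\<close>, this is 0 for negative x. That absorbs the bracket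
  [n > l], since \<open>expo l n\<close> is nonnegative exactly when n > l.\<close>

definition binom_nonneg :: "int \<Rightarrow> nat \<Rightarrow> rat" where
  "binom_nonneg x l = (if x \<ge> 0 then of_nat (nat x choose l) else 0)"

text \<open>The number (n - l)^* of the theorem, always below p - 1.\<close>

definition \<kappa> :: "nat \<Rightarrow> nat \<Rightarrow> nat" where
  "\<kappa> l n = nat ((int l - int n) mod (int p - 1))"

text \<open>The Bernoulli side without the binomial of s and t and up to sign: the product of the
  factorial and the Bernoulli value is congruent to a sign times \<open>quot_coeff\<close>.\<close>

definition bern_side :: "nat \<Rightarrow> nat \<Rightarrow> rat" where
  "bern_side l n = binom_nonneg (expo l n) l * (- 1) ^ n * quot_coeff r n (\<kappa> l n)"

text \<open>Pascal's rule fails only at l = x = 0, where the truncated binomial jumps from 0 to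
  1.\<close>

lemma binom_nonneg_pascal:
  assumes "l > 0 \<or> x \<noteq> 0"
  shows "binom_nonneg x l = (if l = 0 then 0 else binom_nonneg (x - 1) (l - 1)) + binom_nonneg (x - 1) l"
proof (cases "x > 0")
  case True
  then obtain m where m: "nat x = Suc m" by (metis gr0_implies_Suc zero_less_nat_eq)
  moreover from m have "nat (x - 1) = m" by simp
  ultimately show ?thesis using True unfolding binom_nonneg_def by (cases l) auto
next
  case False
  then show ?thesis using assms unfolding binom_nonneg_def by (cases l) auto
qed

lemma pint_binom_nonneg: "pint (binom_nonneg x l)"
  by (simp add: binom_nonneg_def)

text \<open>Exponent and residue come from a single division with remainder by p - 1; one linear
  equation therefore determines both.\<close>

lemma expo_kappa_I:
  assumes "k < p - 1" "int n + int k = int l + (int p - 1) * (e + 1)"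
  shows "expo l n = e" "\<kappa> l n = k"
proof -
  have pk: "int k < int p - 1" using assms(1) by simp
  have "int n - int l - 1 = (int p - 1) * e + (int p - 2 - int k)"
    using assms(2) by (simp add: algebra_simps)
  then show "expo l n = e"
    unfolding expo_def using pk by (intro int_div_pos_eq[of _ _ _ "int p - 2 - int k"]) auto
  have "int l - int n = (int p - 1) * (- (e + 1)) + int k"
    using assms(2) by (simp add: algebra_simps)
  then have "(int l - int n) mod (int p - 1) = int k"
    using pk by (intro int_mod_pos_eq[of _ _ "- (e + 1)"]) auto
  then show "\<kappa> l n = k" unfolding \<kappa>_def by simp
qed

lemma kappa_less: "\<kappa> l n < p - 1"
proof -
  have "(int l - int n) mod (int p - 1) < int p - 1" using p_gt1 by (intro pos_mod_bound) simp
  then show ?thesis unfolding \<kappa>_def using p_gt1 by (simp add: nat_less_iff)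
qed

lemma expo_kappa: "int n + int (\<kappa> l n) = int l + (int p - 1) * (expo l n + 1)"
proof -
  let ?d = "int p - 1"
  have d: "?d > 0" using p_gt1 by simp
  define k where "k = (int l - int n) mod ?d"
  have k: "0 \<le> k" "k < ?d" unfolding k_def using d by auto
  obtain e where e: "int l - int n = k + ?d * e"
    unfolding k_def by (metis mod_mult_div_eq)
  have "int n + int (nat k) = int l + ?d * ((- e - 1) + 1)"
    using e k by (simp add: algebra_simps)
  with expo_kappa_I[of "nat k" n l "- e - 1"] k show ?thesis by auto
qed

lemma pint_bern_side: "pint (bern_side l n)"
  unfolding bern_side_def using kappa_less pint_of_int[of "(-1) ^ n"]
  by (intro pint_mult pint_binom_nonneg pint_quot_coeff) auto

text \<open>Write K and k for the exponent and residue at n + p. The indices i with exponent K - 1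
  are exactly 1, ..., k + 1, and the residue there is k + 1 - i. So the sum is the logarithmic one
  of \<open>quot_coeff_log\<close>, and Pascal's rule for the binomial factors finishes after n + p
  has been replaced by n.\<close>

lemma bern_side_rec:
  "(- 1) ^ p * bern_side l (n + p) \<simeq> (if l = 0 then 0 else bern_side (l - 1) n)
     - (\<Sum>i\<in>{1..<p}. if expo l (n + i) = expo l (n + p) - 1 then bern_side l (n + i) / of_nat i else 0)"
proof -
  define K where "K = expo l (n + p)"
  define k where "k = \<kappa> l (n + p)"
  have k: "k < p - 1" unfolding k_def by (rule kappa_less)
  have eq: "int n + int p + int k = int l + (int p - 1) * (K + 1)"
    using expo_kappa[of "n + p" l] unfolding K_def k_def by simp
  have G1: "bern_side (l - 1) n = binom_nonneg (K - 1) (l - 1) * (-1) ^ n * quot_coeff r n k" if "l > 0"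
  proof -
    have "int n + int k = int (l - 1) + (int p - 1) * ((K - 1) + 1)"
      using eq that by (simp add: of_nat_diff algebra_simps)
    with expo_kappa_I[OF k this] show ?thesis by (simp add: bern_side_def)
  qed
  have "(\<Sum>i\<in>{1..<p}. if expo l (n + i) = K - 1 then bern_side l (n + i) / of_nat i else 0)
     = (\<Sum>i\<in>{1..Suc k}. binom_nonneg (K - 1) l * (- 1) ^ n * ((- 1) ^ i * quot_coeff r (n + i) (Suc k - i) / of_nat i))"
  proof (rule sum.mono_neutral_cong_right)
    show "{1..Suc k} \<subseteq> {1..<p}" using k by auto
    show "\<forall>i\<in>{1..<p} - {1..Suc k}. (if expo l (n + i) = K - 1 then bern_side l (n + i) / of_nat i else 0) = 0"
    proof
      fix i assume i: "i \<in> {1..<p} - {1..Suc k}"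
      have "expo l (n + i) \<noteq> K - 1"
      proof
        assume "expo l (n + i) = K - 1"
        then have "int (n + i) + int (\<kappa> l (n + i)) = int l + (int p - 1) * K"
          using expo_kappa[of "n + i" l] by simp
        then have "int i + int (\<kappa> l (n + i)) = int k + 1"
          using eq by (simp add: algebra_simps)
        then show False using i by auto
      qed
      then show "(if expo l (n + i) = K - 1 then bern_side l (n + i) / of_nat i else 0) = 0" by simp
    qed
    fix i assume i: "i \<in> {1..Suc k}"
    have "int (n + i) + int (Suc k - i) = int l + (int p - 1) * ((K - 1) + 1)"
      using eq i by (simp add: of_nat_diff algebra_simps)
    moreover have "Suc k - i < p - 1" using k i by auto
    ultimately have "expo l (n + i) = K - 1" "\<kappa> l (n + i) = Suc k - i"
      using expo_kappa_I by blast+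
    then show "(if expo l (n + i) = K - 1 then bern_side l (n + i) / of_nat i else 0)
      = binom_nonneg (K - 1) l * (- 1) ^ n * ((- 1) ^ i * quot_coeff r (n + i) (Suc k - i) / of_nat i)"
      by (simp add: bern_side_def power_add)
  qed auto
  also have "\<dots> = - (binom_nonneg (K - 1) l * (- 1) ^ n * quot_coeff r n k)"
    unfolding sum_distrib_left[symmetric] quot_coeff_log by simp
  finally have sum: "(\<Sum>i\<in>{1..<p}. if expo l (n + i) = K - 1 then bern_side l (n + i) / of_nat i else 0)
     = - (binom_nonneg (K - 1) l * (- 1) ^ n * quot_coeff r n k)" .
  \<comment> \<open>The bad case of Pascal's rule cannot occur: l = K = 0 would give n + p + k = p -
    1.\<close>
  have "l > 0 \<or> K \<noteq> 0"
  proof (cases "l = 0")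
    case True
    have "int k < int p - 1" using k by simp
    then have "K \<noteq> 0" using eq True by auto
    then show ?thesis by simp
  qed simp
  note pascal = binom_nonneg_pascal[OF this]
  have "(- 1) ^ p * bern_side l (n + p) = binom_nonneg K l * (-1) ^ n * quot_coeff r (n + p) k"
    unfolding bern_side_def K_def[symmetric] k_def[symmetric]
    by (simp add: power_add mult.assoc power_mult_distrib[symmetric] mult.left_commute[of "(-1) ^ p"] flip: mult.assoc)
  also have "\<dots> \<simeq> binom_nonneg K l * (-1) ^ n * quot_coeff r n k"
    using pint_of_int[of "(-1) ^ n"] k
    by (intro rcong_cmult pint_mult pint_binom_nonneg quot_coeff_add_p) auto
  also have "\<dots> = (if l = 0 then 0 else bern_side (l - 1) n)
     - (\<Sum>i\<in>{1..<p}. if expo l (n + i) = K - 1 then bern_side l (n + i) / of_nat i else 0)"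
    unfolding sum pascal using G1 by (cases "l = 0") (auto simp: algebra_simps)
  finally show ?thesis unfolding K_def .
qed

section \<open>Initial values: N below p^a\<close>

lemma fermat_int: "[x ^ (p - 1) = (if int p dvd x then 0 else 1)] (mod int p)"
proof (cases "int p dvd x")
  case True
  then have "[x = 0] (mod int p)" by (simp add: cong_0_iff)
  from cong_pow[OF this, of "p - 1"] show ?thesis using True p_gt1 by (simp add: power_0_left)
next
  case False
  define m where "m = nat (x mod int p)"
  have m: "int m = x mod int p" unfolding m_def using p_gt0 by simp
  have "\<not> int p dvd int m" unfolding m using False by (simp add: dvd_mod_iff)
  then have "[m ^ (p - 1) = 1] (mod p)" by (intro fermat_theorem prime_p) simp
  then have "[int (m ^ (p - 1)) = int 1] (mod int p)" by (simp only: cong_int_iff)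
  then have "[int m ^ (p - 1) = 1] (mod int p)" by simp
  moreover have "[x = int m] (mod int p)" unfolding m by (simp add: cong_def)
  then have "[x ^ (p - 1) = int m ^ (p - 1)] (mod int p)" by (rule cong_pow)
  ultimately show ?thesis using False cong_trans by auto
qed

text \<open>The left side is the coefficient of x^(p - 1) in (1 - e^x)^n e^(-r x), an alternating
  sum of (k - r)^(p - 1) / (p - 1)!. Fermat makes each power 0 or 1 and Wilson makes 1 / (p - 1)!
  equal to -1.\<close>

lemma quot_coeff_fermat:
  assumes "0 < n" "n < p"
  shows "(- 1) ^ n * quot_coeff r n (p - 1 - n) \<simeq> (- 1) ^ nat (r mod int p) * of_nat (n choose nat (r mod int p))"
proof -
  define r0 where "r0 = nat (r mod int p)"
  have r0: "int r0 = r mod int p" "r0 < p" unfolding r0_def using p_gt0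
    by (simp_all add: nat_less_iff)
  have "(- 1) ^ n * quot_coeff r n (p - 1 - n) = fps_nth ((1 - fps_exp 1) ^ n * fps_exp (- of_int r)) (p - 1)"
    unfolding exp_quot_power quot_coeff_def mult.assoc fps_mult_left_const_nth fps_X_power_mult_nth
    using assms by simp
  also have "(1 - fps_exp 1) ^ n * fps_exp (- of_int r)
     = (\<Sum>k\<le>n. fps_const (of_nat (n choose k) * (- 1) ^ k) * fps_exp (of_int (int k - r)) :: rat fps)"
    by (simp add: one_minus_exp_power_mult)
  also have "fps_nth \<dots> (p - 1)
     = (\<Sum>k\<le>n. of_nat (n choose k) * (- 1) ^ k * (of_int ((int k - r) ^ (p - 1)) * (1 / fact (p - 1))))"
    by (simp add: fps_sum_nth)
  also have "\<dots> \<simeq> (\<Sum>k\<le>n. of_nat (n choose k) * (- 1) ^ k * ((if k = r0 then 0 else 1) * - 1))"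
  proof (intro rcong_sum rcong_cmult)
    fix k assume k: "k \<in> {..n}"
    show "pint (of_nat (n choose k) * (- 1) ^ k)"
      using pint_of_int[of "int (n choose k) * (-1) ^ k"] by simp
    have "[(int k - r) ^ (p - 1) = (if k = r0 then 0 else 1)] (mod int p)"
    proof -
      have "int p dvd int k - r \<longleftrightarrow> int k mod int p = r mod int p" by (simp add: mod_eq_dvd_iff)
      also have "int k mod int p = int k" using k assms by simp
      also have "int k = r mod int p \<longleftrightarrow> k = r0" unfolding r0(1)[symmetric] by simp
      finally show ?thesis using fermat_int[of "int k - r"] by simp
    qed
    from rcong_of_int[OF this]
    have "of_int ((int k - r) ^ (p - 1)) \<simeq> (if k = r0 then 0 else 1)" by (simp split: if_splits)
    then show "of_int ((int k - r) ^ (p - 1)) * (1 / fact (p - 1)) \<simeq> (if k = r0 then 0 else 1) * - 1"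
      using inverse_fact_p_minus1 pint_of_int[of "-1"] by (intro rcong_mult) auto
  qed
  \<comment> \<open>The indicator of k different from r0 is 1 minus that of k = r0. The full
    alternating sum of binomials vanishes because n > 0.\<close>
  also have "\<dots> = (\<Sum>k\<le>n. (if k = r0 then of_nat (n choose r0) * (- 1) ^ r0 else 0)
       - (- 1) ^ k * of_nat (n choose k))"
    by (intro sum.cong) auto
  also have "\<dots> = (if r0 \<le> n then of_nat (n choose r0) * (- 1) ^ r0 else 0)"
    using choose_alternating_sum[of n] assms by (simp add: sum_subtractf)
  also have "\<dots> = (- 1) ^ r0 * of_nat (n choose r0)" by (auto simp: binomial_eq_0)
  finally show ?thesis unfolding r0_def .
qed

lemma pint_residue_binom: "pint (residue_binom l k)"
proof -
  have "pint (of_int x gchoose l)" for x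
  proof (cases "x \<ge> 0")
    case True
    then have "(of_int x :: rat) = of_nat (nat x)" by simp
    then show ?thesis by (simp only: binomial_gbinomial[symmetric] pint_of_nat)
  next
    \<comment> \<open>Negative upper arguments reduce to ordinary binomials by upper
      negation.\<close>
    case False
    define m where "m = nat (int l - x - 1)"
    have "int m = int l - x - 1" using False unfolding m_def by simp
    then have "(of_int (int m) :: rat) = of_int (int l - x - 1)" by (simp only:)
    then have m: "(of_nat l - of_int x - 1 :: rat) = of_nat m" by simp
    have "(of_int x gchoose l :: rat) = (-1) ^ l * (of_nat m gchoose l)"
      by (subst gbinomial_negated_upper) (simp only: m)
    also have "\<dots> = of_int ((-1) ^ l * int (m choose l))"
      by (simp add: binomial_gbinomial[symmetric])
    finally have "(of_int x gchoose l :: rat) = of_int ((-1) ^ l * int (m choose l))" .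
    then show ?thesis by (simp only: pint_of_int)
  qed
  then show ?thesis unfolding residue_binom_def by auto
qed

lemma pint_fleck_sum: "pint (fleck_sum l N)"
  unfolding fleck_sum_def alt_binom_sum_def
proof (intro pint_sum pint_mult pint_residue_binom)
  show "pint ((-1) ^ k)" for k using pint_of_int[of "(-1) ^ k"] by simp
qed simp

text \<open>For l = 0 and n > 0 the exponent is 0 and a single k of the residue class lies below
  \<open>p ^ a\<close>, so Lucas and \<open>quot_coeff_fermat\<close> apply. In all other cases the
  left side carries a positive power of p and the binomial on the right is 0.\<close>

lemma fleck_base:
  assumes "N < p ^ a"
  shows "fleck l N \<simeq> (- 1) ^ t * of_nat (N mod P choose t) * bern_side l (N div P)"
proof -
  define n s where "n = N div P" and "s = N mod P"
  have N: "N = P * n + s" unfolding n_def s_def by simp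
  have s: "s < P" unfolding s_def using P_pos by simp
  have n: "n < p" unfolding n_def using assms by (simp add: pa less_mult_imp_div_less mult.commute)
  show ?thesis
  proof (cases "l = 0 \<and> n > 0")
    case True
    then have l: "l = 0" and n0: "n > 0" by auto
    have "int n + int (p - 1 - n) = int l + (int p - 1) * (0 + 1)"
      using n l by (simp add: of_nat_diff)
    moreover have "p - 1 - n < p - 1" using n0 n by simp
    ultimately have Ek: "expo l n = 0" "\<kappa> l n = p - 1 - n" using expo_kappa_I by blast+
    define r0 where "r0 = nat (r mod int p)"
    have r0: "int r0 = r mod int p" "r0 < p" unfolding r0_def using p_gt0
      by (simp_all add: nat_less_iff)
    \<comment> \<open>The representative of \<rho> modulo \<open>p ^ a\<close> in the range from 0
      to \<open>p ^ a - 1\<close>.\<close>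
    define k0 where "k0 = P * r0 + t"
    have "\<rho> - int k0 = int P * (r - r mod int p)"
      unfolding \<rho>_def k0_def using r0 by (simp add: algebra_simps)
    also have "\<dots> = int (p ^ a) * (r div int p)"
      unfolding pa by (simp add: minus_mod_eq_mult_div)
    finally have "int (p ^ a) dvd \<rho> - int k0" by simp
    then have d: "int (p ^ a) dvd int k - \<rho> \<longleftrightarrow> int (p ^ a) dvd int k - int k0" for k
      using dvd_add_left_iff[of "int (p ^ a)" "\<rho> - int k0" "int k - \<rho>"] by simp
    have "P * r0 + t < P * Suc r0" using t_less by simp
    also have "\<dots> \<le> P * p" using r0 by (intro mult_le_mono2) simp
    finally have k0: "k0 < p ^ a" unfolding k0_def pa .
    have dk: "int (p ^ a) dvd int k - \<rho> \<longleftrightarrow> k = k0" if "k < p ^ a" for k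
    proof -
      have "int (p ^ a) dvd int k - int k0 \<longleftrightarrow> int k mod int (p ^ a) = int k0 mod int (p ^ a)"
        by (simp add: mod_eq_dvd_iff)
      also have "\<dots> \<longleftrightarrow> k = k0" using that k0 by (simp only: zmod_int[symmetric]) simp
      finally show ?thesis using d by simp
    qed
    have "fleck l N = fleck_sum 0 N" unfolding fleck_def using Ek l n_def by simp
    also have "\<dots> = (\<Sum>k\<le>N. if k = k0 then of_nat (N choose k0) * (-1) ^ k0 else 0)"
      unfolding fleck_sum_def alt_binom_sum_def residue_binom_def
      using assms dk by (intro sum.cong) auto
    also have "\<dots> = of_nat (N choose k0) * (-1) ^ k0" by (simp add: binomial_eq_0)
    also have "\<dots> \<simeq> of_nat ((n choose r0) * (s choose t)) * ((-1) ^ r0 * (-1) ^ t)"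
    proof (intro rcong_mult)
      show "of_nat (N choose k0) \<simeq> of_nat ((n choose r0) * (s choose t))"
        unfolding N k0_def using s t_less by (rule lucas_prime_power)
      have "((-1) ^ P) ^ r0 * (-1) ^ t \<simeq> (-1) ^ r0 * (-1) ^ t"
        using minus1_power_prime_power[of "a - 1"] pint_of_int[of "-1"] pint_of_int[of "(-1)^t"] pint_of_int[of "(-1)^P"]
        by (intro rcong_mult rcong_power rcong_refl) (auto intro: pint_power)
      then show "(-1) ^ k0 \<simeq> (-1) ^ r0 * (-1) ^ t"
        unfolding k0_def by (simp add: power_add power_mult)
      show "pint (of_nat (N choose k0))" by simp
      show "pint ((-1) ^ r0 * (-1) ^ t)" using pint_of_int[of "(-1) ^ r0 * (-1) ^ t"] by simp
    qed
    also have "\<dots> = (-1) ^ t * of_nat (s choose t) * ((-1) ^ r0 * of_nat (n choose r0))"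
      by simp
    also have "\<dots> \<simeq> (-1) ^ t * of_nat (s choose t) * ((-1) ^ n * quot_coeff r n (p - 1 - n))"
    proof (rule rcong_cmult)
      show "pint ((-1) ^ t * of_nat (s choose t))"
        using pint_of_int[of "(-1) ^ t * int (s choose t)"] by simp
      show "(-1) ^ r0 * of_nat (n choose r0) \<simeq> (-1) ^ n * quot_coeff r n (p - 1 - n)"
        using quot_coeff_fermat[OF n0 n] unfolding r0_def by (rule rcong_sym)
    qed
    also have "\<dots> = (-1) ^ t * of_nat (s choose t) * bern_side l n"
      unfolding bern_side_def Ek by (simp add: binom_nonneg_def l)
    finally show ?thesis unfolding n_def s_def .
  next
    case False
    have "int n - int l - 1 \<le> int p - 2 - int l" using n by simp
    then have El: "expo l n \<le> (if l = 0 then -1 else 0)"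
    proof (cases "l = 0")
      case True
      then have "n = 0" using False by simp
      then show ?thesis using expo_kappa_I(1)[of 0 n l "-1"] True p_gt1 by simp
    next
      case l: False
      have "expo l n \<le> 0"
      proof (rule ccontr)
        assume "\<not> expo l n \<le> 0"
        \<comment> \<open>A positive exponent would give n + \<open>\<kappa> l n\<close> at least 2
          (p - 1), while n is at most p - 1 and the residue at most p - 2.\<close>
        define X where "X = (int p - 1) * (expo l n + 1)"
        have "(int p - 1) * 2 \<le> X"
          unfolding X_def using p_gt1 \<open>\<not> expo l n \<le> 0\<close> by (intro mult_left_mono) auto
        moreover have "int (\<kappa> l n) < int p - 1" "int n < int p" using kappa_less[of l n] n by simp_all
        moreover have "(int p - 1) * 2 = 2 * int p - 2" "int l \<ge> 0" by simp_all
        ultimately show False using expo_kappa[of n l, folded X_def] by linarith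
      qed
      then show ?thesis using l by simp
    qed
    then have Cp0: "bern_side l n = 0" unfolding bern_side_def binom_nonneg_def by (auto split: if_splits)
    define h where "h = nat (int l - expo l n)"
    have h: "int l - expo l n = int h" "h > 0" using El unfolding h_def by (auto split: if_splits)
    have "fleck l N = of_nat p ^ h * ((-1) ^ h * fleck_sum l N)"
      unfolding fleck_def n_def[symmetric] h(1) using power_minus[of "of_nat p :: rat" h] by simp
    also have "\<dots> \<simeq> 0"
      using h(2) pint_fleck_sum pint_of_int[of "(-1) ^ h"] by (intro rcong_0_power pint_mult) auto
    finally show ?thesis using Cp0 unfolding n_def by simp
  qed
qed

end

section \<open>Solving the recurrence\<close>

context fleck_setting
begin

text \<open>Failure of the Lucas-type congruence: it enters when the exponent of \<open>- p\<close> jumps by two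
  between \<open>N\<close> and \<open>N + p ^ a\<close>, so that the \<open>j\<close> with \<open>p ^ (a - 2) dvd j\<close> contribute to the recurrence.\<close>

definition defect_factor :: "nat \<Rightarrow> rat" where
  "defect_factor s = (\<Sum>i\<in>{1..<p}. if s + Q * i < P then (- 1) ^ t * of_nat (s + Q * i choose t) / of_nat i else 0)"

text \<open>For nonnegative x this is (l + 1) times the binomial of x over l + 1. The written form
  shows the factor x - l, which becomes divisible by p when p divides n.\<close>

definition defect :: "nat \<Rightarrow> int \<Rightarrow> rat" where
  "defect l x = of_int (x - int l) * binom_nonneg x l"

text \<open>The exponent jumps by two between n and n + p exactly when n + p is exceptional.\<close>

definition exceptional :: "nat \<Rightarrow> nat \<Rightarrow> bool" where
  "exceptional l n \<longleftrightarrow> (int p - 1) dvd (int n - int l - 1)"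

text \<open>The value of the quotient modulo p without any of the three conditions: the expected
  term plus a correction in the exceptional case.\<close>

definition fleck_residue :: "nat \<Rightarrow> nat \<Rightarrow> rat" where
  "fleck_residue l N = (- 1) ^ t * of_nat (N mod P choose t) * bern_side l (N div P)
     + (if exceptional l (N div P)
        then defect_factor (N mod P) * (- 1) ^ (N div P) * defect l (expo l (N div P) - 1) else 0)"

lemma pint_minus1_power [simp]: "pint ((- 1) ^ k)"
  using pint_of_int[of "(-1) ^ k"] by simp

lemma pint_divide_less: "i \<in> {1..<p} \<Longrightarrow> pint x \<Longrightarrow> pint (x / of_nat i)"
  by (rule pint_divide) (auto dest: dvd_imp_le)

lemma pint_defect_factor: "pint (defect_factor s)"
  unfolding defect_factor_def by (intro pint_sum) (auto intro!: pint_divide_less pint_mult)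

lemma pint_defect: "pint (defect l x)"
  unfolding defect_def by (intro pint_mult pint_binom_nonneg pint_of_int)

lemma pint_fleck_residue: "pint (fleck_residue l N)"
  unfolding fleck_residue_def by (auto intro!: pint_add pint_mult pint_defect_factor pint_defect pint_bern_side)

text \<open>Pascal's rule is multiplied by x - l, written once as (x - 1) - (l - 1) and once as (x -
  1 - l) + 1; the last 1 yields the inhomogeneous term.\<close>

lemma defect_pascal:
  "defect l x = (if l = 0 then 0 else defect (l - 1) (x - 1)) + defect l (x - 1) + binom_nonneg (x - 1) l"
proof (cases "l > 0 \<or> x \<noteq> 0")
  case True
  have "defect l x = of_int (x - int l) * ((if l = 0 then 0 else binom_nonneg (x - 1) (l - 1)) + binom_nonneg (x - 1) l)"
    unfolding defect_def using binom_nonneg_pascal[OF True] by simp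
  then show ?thesis unfolding defect_def by (auto simp: of_nat_diff algebra_simps)
next
  case False
  then show ?thesis by (simp add: defect_def binom_nonneg_def)
qed

lemma exceptional_E:
  assumes "exceptional l n"
  shows "int n = int l + 1 + (int p - 1) * expo l n" "\<kappa> l n = p - 2"
proof -
  obtain c where c: "int n - int l - 1 = (int p - 1) * c"
    using assms unfolding exceptional_def by auto
  have "int n + int (p - 2) = int l + (int p - 1) * (c + 1)"
    using c p_gt1 by (simp add: of_nat_diff algebra_simps)
  moreover have "p - 2 < p - 1" using p_gt1 by simp
  ultimately have "expo l n = c" "\<kappa> l n = p - 2" using expo_kappa_I by blast+
  then show "int n = int l + 1 + (int p - 1) * expo l n" "\<kappa> l n = p - 2" using c by simp_all
qed

text \<open>An exceptional number is the first with its exponent. If n + i is the first with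
  exponent K - 1, where K belongs to n + p, then n + i + p - 1 is the first with exponent K and
  hence at most n + p, so i = 1.\<close>

lemma exceptional_block:
  assumes i: "i \<in> {1..<p}"
  shows "expo l (n + i) = expo l (n + p) - 1 \<and> exceptional l (n + i) \<longleftrightarrow> i = 1 \<and> exceptional l (n + p)"
proof
  assume *: "i = 1 \<and> exceptional l (n + p)"
  have "expo l (n + p) = expo l (n + 1) + 1" using expo_add[of l "n + 1"] p_gt0 by simp
  moreover have "int (n + p) - int l - 1 = (int (n + 1) - int l - 1) + (int p - 1)" by simp
  then have "exceptional l (n + 1)"
    using * unfolding exceptional_def by (metis dvd_add_triv_right_iff)
  ultimately show "expo l (n + i) = expo l (n + p) - 1 \<and> exceptional l (n + i)" using * by simp
next
  assume *: "expo l (n + i) = expo l (n + p) - 1 \<and> exceptional l (n + i)"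
  define X where "X = (int p - 1) * expo l (n + p)"
  have "int (n + i) = int l + 1 + (int p - 1) * (expo l (n + p) - 1)"
    using exceptional_E(1)[of l "n + i"] * by simp
  then have 1: "int n + int i = int l + 1 + X - (int p - 1)"
    unfolding X_def by (simp add: algebra_simps)
  have 2: "int n + int p + int (\<kappa> l (n + p)) = int l + X + (int p - 1)"
    using expo_kappa[of "n + p" l] unfolding X_def by (simp add: algebra_simps)
  have 3: "int (\<kappa> l (n + p)) \<le> int p - 2" using kappa_less[of l "n + p"] by simp
  have i1: "i = 1" using 1 2 3 i by simp
  have "int (n + p) - int l - 1 = (int p - 1) * expo l (n + p)" using 1 i1 unfolding X_def by simp
  then show "i = 1 \<and> exceptional l (n + p)" using i1 unfolding exceptional_def by simp
qed

text \<open>The regular parts obey \<open>bern_side_rec\<close>. The three sources of defect, namely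
  the term for l - 1, the summand i = 1 and the sum over steps of Q, add up by
  \<open>defect_pascal\<close> at K - 1.\<close>

lemma fleck_residue_rec:
  fixes M :: nat and l :: nat
  defines "n \<equiv> M div P"
  shows "(- 1) ^ p * fleck_residue l (M + p ^ a)
    \<simeq> (if l = 0 then 0 else fleck_residue (l - 1) M)
     - (\<Sum>i\<in>{1..<p}. if expo l (n + i) = expo l (n + p) - 1 then fleck_residue l (M + P * i) / of_nat i else 0)
     + (if (int p - 1) dvd (int n - int l)
        then \<Sum>i\<in>{1..<p}. if M mod P + Q * i < P then fleck_residue l (M + Q * i) / of_nat i else 0 else 0)"
proof -
  define s where "s = M mod P"
  define \<sigma> :: rat where "\<sigma> = (- 1) ^ t * of_nat (s choose t)"
  define K where "K = expo l (n + p)"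
  have M: "(M + P * i) div P = n + i" "(M + P * i) mod P = s" for i
    unfolding n_def s_def by (rule div_P_add, simp)
  have exc: "(int p - 1) dvd (int n - int l) \<longleftrightarrow> exceptional l (n + p)"
  proof -
    have "int (n + p) - int l - 1 = (int n - int l) + (int p - 1)" by simp
    then show ?thesis unfolding exceptional_def by (metis dvd_add_triv_right_iff)
  qed
  have A: "(if l = 0 then 0 else fleck_residue (l - 1) M)
    = \<sigma> * (if l = 0 then 0 else bern_side (l - 1) n)
     + (if exceptional l (n + p) then defect_factor s * (- 1) ^ n * (if l = 0 then 0 else defect (l - 1) (K - 2)) else 0)"
  proof (cases "l = 0")
    case False
    then have "int n - int (l - 1) - 1 = int n - int l" by (simp add: of_nat_diff)
    then have "exceptional (l - 1) n \<longleftrightarrow> exceptional l (n + p)"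
      using exc unfolding exceptional_def by simp
    moreover have "expo (l - 1) n = K - 1" unfolding K_def using expo_pred[of l n] False by simp
    ultimately show ?thesis using False unfolding fleck_residue_def n_def[symmetric] s_def[symmetric] \<sigma>_def by simp
  qed simp
  have B: "(\<Sum>i\<in>{1..<p}. if expo l (n + i) = K - 1 then fleck_residue l (M + P * i) / of_nat i else 0)
    = \<sigma> * (\<Sum>i\<in>{1..<p}. if expo l (n + i) = K - 1 then bern_side l (n + i) / of_nat i else 0)
     - (if exceptional l (n + p) then defect_factor s * (- 1) ^ n * defect l (K - 2) else 0)"
  proof -
    have "(\<Sum>i\<in>{1..<p}. if expo l (n + i) = K - 1 then fleck_residue l (M + P * i) / of_nat i else 0)
      = (\<Sum>i\<in>{1..<p}. \<sigma> * (if expo l (n + i) = K - 1 then bern_side l (n + i) / of_nat i else 0)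
          + (if i = 1 then if exceptional l (n + p) then - (defect_factor s * (- 1) ^ n * defect l (K - 2)) else 0 else 0))"
    proof (rule sum.cong)
      fix i assume i: "i \<in> {1..<p}"
      show "(if expo l (n + i) = K - 1 then fleck_residue l (M + P * i) / of_nat i else 0)
        = \<sigma> * (if expo l (n + i) = K - 1 then bern_side l (n + i) / of_nat i else 0)
          + (if i = 1 then if exceptional l (n + p) then - (defect_factor s * (- 1) ^ n * defect l (K - 2)) else 0 else 0)"
        using exceptional_block[OF i, of l n] unfolding fleck_residue_def M \<sigma>_def K_def[symmetric]
        by (cases "expo l (n + i) = K - 1"; cases "exceptional l (n + i)"; cases "i = 1") (simp_all add: add_divide_distrib)
    qed simp
    also have "\<dots> = \<sigma> * (\<Sum>i\<in>{1..<p}. if expo l (n + i) = K - 1 then bern_side l (n + i) / of_nat i else 0)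
       - (if exceptional l (n + p) then defect_factor s * (- 1) ^ n * defect l (K - 2) else 0)"
      using p_gt1 by (simp add: sum.distrib sum_distrib_left[symmetric])
    finally show ?thesis .
  qed
  have C: "(\<Sum>i\<in>{1..<p}. if s + Q * i < P then fleck_residue l (M + Q * i) / of_nat i else 0)
     = defect_factor s * (- 1) ^ n * binom_nonneg (K - 2) l" if "exceptional l (n + p)"
  proof -
    have En: "expo l n = K - 2" using expo_add_p[of l n] exc that unfolding K_def by simp
    have "int n = int l + (int p - 1) * (K - 1)"
      using exceptional_E(1)[OF that] unfolding K_def by (simp add: algebra_simps)
    \<comment> \<open>Degree 0 makes the series coefficient equal to 1, so only the binomial is
      left.\<close>
    then have "\<kappa> l n = 0" using expo_kappa_I(2)[of 0 n l "K - 2"] p_gt1 by simp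
    then have Gn: "bern_side l n = binom_nonneg (K - 2) l * (-1) ^ n" unfolding bern_side_def En by simp
    have summand: "fleck_residue l (M + Q * i) = (- 1) ^ t * of_nat (s + Q * i choose t) * bern_side l n"
      if i: "i \<in> {1..<p}" "s + Q * i < P" for i
    proof -
      have "M + Q * i = P * n + (s + Q * i)" unfolding n_def s_def by simp
      then have dm: "(M + Q * i) div P = n" "(M + Q * i) mod P = s + Q * i"
        using div_mod_P[OF i(2), of n] by (simp_all only:)
      \<comment> \<open>If n and n + p were both exceptional, p - 1 would divide 1, so p = 2 and P =
        2 * Q. After one step of Q no further step fits below P, and the sum is empty.\<close>
      have "defect_factor (s + Q * i) = 0" if ex: "exceptional l n"
      proof -
        have "int n - int l = (int n - int l - 1) + 1" by simp
        then have "(int p - 1) dvd 1"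
          using ex exc \<open>exceptional l (n + p)\<close> unfolding exceptional_def
          by (metis dvd_add_right_iff)
        then have p2: "p = 2" using p_gt1 by auto
        have "a \<noteq> 1" using i by auto
        then have "a - 1 = Suc (a - 2)" using a_pos by simp
        then have "P = 2 * Q" unfolding p2 by simp
        moreover have "Q * i \<ge> Q" using i by simp
        ultimately have "P \<le> s + Q * i + Q * j" if "j \<ge> 1" for j
          using that mult_le_mono2[of 1 j Q] by linarith
        then have "\<not> s + Q * i + Q * j < P" if "j \<in> {1..<p}" for j
          using that by (simp add: not_less)
        then show ?thesis unfolding defect_factor_def by (intro sum.neutral ballI if_not_P)
      qed
      then show ?thesis unfolding fleck_residue_def dm by auto
    qed
    have "(\<Sum>i\<in>{1..<p}. if s + Q * i < P then fleck_residue l (M + Q * i) / of_nat i else 0)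
       = defect_factor s * bern_side l n"
      unfolding defect_factor_def sum_distrib_right using summand by (intro sum.cong) auto
    then show ?thesis unfolding Gn by simp
  qed
  have "(- 1) ^ p * fleck_residue l (M + p ^ a)
     = \<sigma> * ((- 1) ^ p * bern_side l (n + p))
      + (if exceptional l (n + p) then defect_factor s * (- 1) ^ n * defect l (K - 1) else 0)"
    unfolding pa fleck_residue_def M \<sigma>_def K_def
    by (simp add: distrib_left power_add mult.left_commute[of "(-1) ^ p"] power_mult_distrib[symmetric] flip: mult.assoc)
  also have "\<dots> \<simeq> \<sigma> * ((if l = 0 then 0 else bern_side (l - 1) n)
     - (\<Sum>i\<in>{1..<p}. if expo l (n + i) = K - 1 then bern_side l (n + i) / of_nat i else 0))
      + (if exceptional l (n + p) then defect_factor s * (- 1) ^ n * defect l (K - 1) else 0)"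
    unfolding K_def \<sigma>_def by (intro rcong_add rcong_cmult bern_side_rec rcong_refl pint_mult) simp_all
  also have "\<dots> = (if l = 0 then 0 else fleck_residue (l - 1) M)
     - (\<Sum>i\<in>{1..<p}. if expo l (n + i) = K - 1 then fleck_residue l (M + P * i) / of_nat i else 0)
     + (if exceptional l (n + p)
        then \<Sum>i\<in>{1..<p}. if s + Q * i < P then fleck_residue l (M + Q * i) / of_nat i else 0 else 0)"
    unfolding A B using C defect_pascal[of l "K - 1"] by (auto simp: algebra_simps)
  finally show ?thesis unfolding exc K_def s_def .
qed

text \<open>Both sides satisfy the same recurrence modulo p, so strong induction reduces the claim
  to N < \<open>p ^ a\<close>.\<close>

lemma fleck_cong: "fleck l N \<simeq> fleck_residue l N"
proof (induction N arbitrary: l rule: less_induct)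
  case (less N)
  show ?case
  proof (cases "N < p ^ a")
    case True
    have "N div P < p" using True by (simp add: pa less_mult_imp_div_less mult.commute)
    \<comment> \<open>For an exceptional n below p the exponent is at most 0, so the truncated
      binomial in the defect has a negative upper argument.\<close>
    then have "defect l (expo l (N div P) - 1) = 0" if "exceptional l (N div P)"
    proof -
      have "expo l (N div P) \<le> 0"
      proof (rule ccontr)
        assume "\<not> expo l (N div P) \<le> 0"
        then have "(int p - 1) * 1 \<le> (int p - 1) * expo l (N div P)"
          using p_gt1 by (intro mult_left_mono) auto
        then show False using exceptional_E(1)[OF that] \<open>N div P < p\<close> by simp
      qed
      then show ?thesis by (simp add: defect_def binom_nonneg_def)
    qed
    then show ?thesis using fleck_base[OF True, of l] unfolding fleck_residue_def by simp
  next
    case False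
    define M where "M = N - p ^ a"
    have q0: "p ^ a > 0" using p_gt0 by simp
    have N: "N = M + p ^ a" using False unfolding M_def by simp
    define n where "n = M div P"
    have IH: "fleck l' (M + j) \<simeq> fleck_residue l' (M + j)" if "j < p ^ a" for j l'
      using less.IH that unfolding N by simp
    have Pi: "P * i < p ^ a" if "i \<in> {1..<p}" for i
      unfolding pa using that P_pos by simp
    have sq: "(- 1 :: rat) ^ (p ^ a) * ((- 1) ^ (p ^ a) * x) = x" for x
      by (simp add: mult.assoc[symmetric] power_mult_distrib[symmetric])
    have "(- 1) ^ (p ^ a) * fleck l (M + p ^ a)
      \<simeq> (if l = 0 then 0 else fleck (l - 1) M)
     - (\<Sum>i\<in>{1..<p}. if expo l (n + i) = expo l (n + p) - 1 then fleck l (M + P * i) / of_nat i else 0)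
     + (if (int p - 1) dvd (int n - int l)
        then \<Sum>i\<in>{1..<p}. if M mod P + Q * i < P then fleck l (M + Q * i) / of_nat i else 0 else 0)"
      unfolding n_def using rcong_pint[OF IH pint_fleck_residue] by (intro fleck_rec) auto
    also have "\<dots> \<simeq> (if l = 0 then 0 else fleck_residue (l - 1) M)
     - (\<Sum>i\<in>{1..<p}. if expo l (n + i) = expo l (n + p) - 1 then fleck_residue l (M + P * i) / of_nat i else 0)
     + (if (int p - 1) dvd (int n - int l)
        then \<Sum>i\<in>{1..<p}. if M mod P + Q * i < P then fleck_residue l (M + Q * i) / of_nat i else 0 else 0)"
      (is "?a - ?b + ?c \<simeq> ?a' - ?b' + ?c'")
    proof (intro rcong_add rcong_diff)
      have div: "x / of_nat i \<simeq> y / of_nat i" if "i \<in> {1..<p}" "x \<simeq> y" for i x y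
        using rcong_cmult[OF pint_divide_less[OF that(1) pint_numeral(2)] that(2)] by simp
      have "fleck (l - 1) M \<simeq> fleck_residue (l - 1) M" using IH[of 0] q0 by simp
      then show "?a \<simeq> ?a'" by simp
      show "?b \<simeq> ?b'"
        by (intro rcong_sum) (use Pi IH div in auto)
      have "fleck l (M + Q * i) / of_nat i \<simeq> fleck_residue l (M + Q * i) / of_nat i"
        if "i \<in> {1..<p}" "M mod P + Q * i < P" for i
      proof -
        have "P \<le> p ^ a" unfolding pa using p_gt0 by simp
        then have "Q * i < p ^ a" using that by linarith
        then show ?thesis using that by (intro div IH)
      qed
      then have "(\<Sum>i\<in>{1..<p}. if M mod P + Q * i < P then fleck l (M + Q * i) / of_nat i else 0)
        \<simeq> (\<Sum>i\<in>{1..<p}. if M mod P + Q * i < P then fleck_residue l (M + Q * i) / of_nat i else 0)"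
        by (intro rcong_sum) auto
      then show "?c \<simeq> ?c'" by simp
    qed
    also have "\<dots> \<simeq> (- 1) ^ p * fleck_residue l (M + p ^ a)"
      unfolding n_def by (rule rcong_sym[OF fleck_residue_rec])
    also have "\<dots> \<simeq> (- 1) ^ (p ^ a) * fleck_residue l (M + p ^ a)"
      using minus1_power_prime_power[of 1] minus1_power_prime_power[of a] pint_fleck_residue
      by (intro rcong_mult rcong_refl) (auto intro: rcong_trans rcong_sym)
    finally have "(- 1) ^ (p ^ a) * fleck l (M + p ^ a) \<simeq> (- 1) ^ (p ^ a) * fleck_residue l (M + p ^ a)" .
    from rcong_cmult[OF pint_minus1_power[of "p ^ a"] this]
    show ?thesis unfolding sq N .
  qed
qed

end

section \<open>Vanishing of the defect and Bernoulli polynomials\<close>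

context prime_modulus
begin

section \<open>Harmonic sums and the digit sum of the defect\<close>

definition harmonic :: "nat \<Rightarrow> rat" where
  "harmonic n = (\<Sum>i\<in>{1..n}. 1 / of_nat i)"

lemma harmonic_Suc: "harmonic (Suc n) = harmonic n + 1 / of_nat (Suc n)"
  by (simp add: harmonic_def)

lemma inverse_reflect:
  assumes "0 < i" "i < p"
  shows "1 / of_nat (p - i) \<simeq> - (1 / of_nat i)"
  unfolding rcong_iff
proof (intro exI conjI)
  show "pint (1 / of_nat (p - i) * (1 / of_nat i))"
    using assms by (intro pint_mult pint_inverse_of_nat) (auto dest: dvd_imp_le)
  show "1 / of_nat (p - i) = - (1 / of_nat i) + of_nat p * (1 / of_nat (p - i) * (1 / of_nat i) :: rat)"
    using assms by (simp add: field_simps of_nat_diff)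
qed

text \<open>Reversing the sum by i -> p - i changes its sign modulo p, and 2 is invertible.\<close>

lemma harmonic_p_minus1:
  assumes "p \<noteq> 2"
  shows "harmonic (p - 1) \<simeq> 0"
proof -
  have "harmonic (p - 1) = (\<Sum>i\<in>{1..p - 1}. 1 / of_nat (p - i))"
    unfolding harmonic_def by (rule sum.reindex_bij_witness[of _ "\<lambda>i. p - i" "\<lambda>i. p - i"]) auto
  also have "\<dots> \<simeq> (\<Sum>i\<in>{1..p - 1}. - (1 / of_nat i))"
    by (intro rcong_sum inverse_reflect) auto
  also have "\<dots> = - harmonic (p - 1)" by (simp add: harmonic_def sum_negf)
  finally have "harmonic (p - 1) + harmonic (p - 1) \<simeq> - harmonic (p - 1) + harmonic (p - 1)"
    by (rule rcong_add) simp
  then have "of_nat 2 * harmonic (p - 1) \<simeq> of_nat 2 * 0" by simp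
  moreover have "\<not> p dvd 2" using assms p_gt1 by (auto dest: dvd_imp_le)
  ultimately show ?thesis by (rule rcong_mult_cancel[rotated])
qed

lemma harmonic_reflect:
  assumes "p \<noteq> 2" "j < p"
  shows "harmonic (p - 1 - j) \<simeq> harmonic j"
  using assms(2)
proof (induction j)
  case 0
  then show ?case using harmonic_p_minus1[OF assms(1)] by (simp add: harmonic_def)
next
  case (Suc j)
  have "p - 1 - j = Suc (p - 1 - Suc j)" using Suc.prems by simp
  then have "harmonic (p - 1 - j) = harmonic (p - 1 - Suc j) + 1 / of_nat (p - Suc j)"
    using harmonic_Suc[of "p - 1 - Suc j"] by simp
  then have "harmonic (p - 1 - Suc j) = harmonic (p - 1 - j) - 1 / of_nat (p - Suc j)" by simp
  also have "\<dots> \<simeq> harmonic j - - (1 / of_nat (Suc j))"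
    using Suc by (intro rcong_diff inverse_reflect) auto
  finally show ?case by (simp add: harmonic_Suc)
qed

text \<open>The part of \<open>defect_factor\<close> that depends on the leading digits x =
  \<open>s div Q\<close> and y = \<open>t div Q\<close>.\<close>

definition binom_harmonic :: "nat \<Rightarrow> nat \<Rightarrow> rat" where
  "binom_harmonic x y = (\<Sum>i\<in>{1..<p}. if x + i < p then of_nat (x + i choose y) / of_nat i else 0)"

text \<open>Pascal's rule holds termwise except at the boundary index i = p - 1 - x, whose extra
  term contains the binomial of p over y + 1 and is divisible by p.\<close>

lemma binom_harmonic_pascal:
  assumes "Suc x < p" "Suc y < p"
  shows "binom_harmonic (Suc x) (Suc y) \<simeq> binom_harmonic x (Suc y) + binom_harmonic x y"
proof -
  let ?m = "p - 1 - x"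
  have pc: "p choose Suc y = (p - 1 choose y) + (p - 1 choose Suc y)"
    using p_gt0 by (metis Suc_diff_1 binomial_Suc_Suc)
  have "binom_harmonic x (Suc y) + binom_harmonic x y
     = (\<Sum>i\<in>{1..<p}. if x + i < p then of_nat (Suc x + i choose Suc y) / of_nat i else 0)"
    unfolding binom_harmonic_def sum.distrib[symmetric]
    by (intro sum.cong) (auto simp: add_divide_distrib)
  also have "\<dots> = (\<Sum>i\<in>{1..<p}. (if Suc x + i < p then of_nat (Suc x + i choose Suc y) / of_nat i else 0)
      + (if i = ?m then of_nat (p choose Suc y) / of_nat ?m else 0))"
    using assms by (intro sum.cong) (auto simp: pc)
  also have "\<dots> = binom_harmonic (Suc x) (Suc y) + of_nat (p choose Suc y) / of_nat ?m"
    unfolding binom_harmonic_def using assms by (simp add: sum.distrib)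
  also have "\<dots> \<simeq> binom_harmonic (Suc x) (Suc y) + 0"
  proof (intro rcong_add rcong_refl)
    have "of_nat (p choose Suc y) * (1 / of_nat ?m) \<simeq> 0"
      using choose_prime_power_dvd[of "Suc y" 1] assms
      by (intro rcong_0_mult(1) rcong_0_dvd pint_inverse_of_nat) (auto dest: dvd_imp_le)
    then show "of_nat (p choose Suc y) / of_nat ?m \<simeq> 0" by simp
  qed
  finally show ?thesis by (simp add: rcong_sym)
qed

text \<open>Induction on y, and for each y downwards in x from p - 1, where the sum is empty. The
  closed form vanishes for x = 2 y, which is what condition (ii) requires.\<close>

lemma binom_harmonic_cong:
  assumes "p \<noteq> 2" "y \<le> x" "x < p"
  shows "binom_harmonic x y \<simeq> of_nat (x choose y) * (harmonic (x - y) - harmonic y)"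
  using assms(2,3)
proof (induction y arbitrary: x)
  case 0
  have "binom_harmonic x 0 = harmonic (p - 1 - x)"
    unfolding binom_harmonic_def harmonic_def
    by (rule sum.mono_neutral_cong_right) auto
  also have "\<dots> \<simeq> harmonic x" using harmonic_reflect assms(1) 0 by simp
  finally show ?case by (simp add: harmonic_def)
next
  case (Suc y)
  define d where "d = p - 1 - x"
  have "x = p - 1 - d" "d < p" unfolding d_def using Suc.prems by auto
  with Suc.prems show ?case
  proof (induction d arbitrary: x)
    case 0
    have "binom_harmonic x (Suc y) = 0"
      unfolding binom_harmonic_def using 0 by (intro sum.neutral) auto
    moreover have "of_nat (x choose Suc y) * (harmonic (x - Suc y) - harmonic (Suc y))
       \<simeq> of_nat (x choose Suc y) * (harmonic (Suc y) - harmonic (Suc y))"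
      using 0 harmonic_reflect[OF assms(1), of "Suc y"]
      by (intro rcong_cmult rcong_diff) auto
    ultimately show ?case by (simp add: rcong_sym)
  next
    case (Suc d)
    have "Suc x < p" "Suc y < p" "Suc y \<le> Suc x" "Suc x = p - 1 - d" using Suc.prems by auto
    with Suc.IH[of "Suc x"] Suc.prems
    have 1: "binom_harmonic (Suc x) (Suc y)
      \<simeq> of_nat (Suc x choose Suc y) * (harmonic (x - y) - harmonic (Suc y))" by simp
    have 2: "binom_harmonic x y \<simeq> of_nat (x choose y) * (harmonic (x - y) - harmonic y)"
      using Suc.prems by (intro \<open>\<And>x. y \<le> x \<Longrightarrow> x < p \<Longrightarrow> _\<close>) auto
    have "binom_harmonic x (Suc y) = (binom_harmonic x (Suc y) + binom_harmonic x y) - binom_harmonic x y"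
      by simp
    also have "\<dots> \<simeq> of_nat (Suc x choose Suc y) * (harmonic (x - y) - harmonic (Suc y))
        - of_nat (x choose y) * (harmonic (x - y) - harmonic y)"
      using rcong_trans[OF rcong_sym[OF binom_harmonic_pascal[OF \<open>Suc x < p\<close> \<open>Suc y < p\<close>]] 1] 2
      by (rule rcong_diff)
    also have "\<dots> = of_nat (x choose Suc y) * (harmonic (x - Suc y) - harmonic (Suc y))"
    proof -
      have xy: "x - y = Suc (x - Suc y)" using Suc.prems by simp
      \<comment> \<open>Absorption balances the two reciprocals by which the harmonic numbers at
        neighbouring arguments differ.\<close>
      have "Suc y * (x choose Suc y) = (x - y) * (x choose y)"
        using binomial_absorb_comp[of x y] by (metis binomial_absorption mult.commute)
      then have "of_nat (Suc y) * of_nat (x choose Suc y) = (of_nat (x - y) * of_nat (x choose y) :: rat)"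
        by (metis of_nat_mult)
      then have "of_nat (x choose Suc y) / of_nat (x - y) = (of_nat (x choose y) / of_nat (Suc y) :: rat)"
        using xy by (simp add: field_simps)
      then show ?thesis
        unfolding xy harmonic_Suc binomial_Suc_Suc of_nat_add by (simp add: algebra_simps)
    qed
    finally show ?case .
  qed
qed

section \<open>Comparison with Bernoulli polynomials of order m\<close>

lemma bernoulli_gen_fps_exp_quot:
  "bernoulli_gen_fps m x * exp_quot ^ m = fps_exp x"
proof -
  have "fps_X ^ m * (bernoulli_gen_fps m x * exp_quot ^ m) = fps_X ^ m * fps_exp x"
    using bernoulli_gen_fps_mult[of m x]
    unfolding X_mult_exp_quot[symmetric] power_mult_distrib by (simp only: mult_ac)
  then show ?thesis by (simp only: mult_left_cancel power_not_zero fps_X_neq_zero simp_thms)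
qed

text \<open>Multiplying the generating series by \<open>exp_quot ^ (m + n)\<close> gives the series
  of \<open>quot_coeff\<close>, and this power is congruent to 1 below degree p - 1. The induction
  on k also supplies the integrality of the lower Bernoulli coefficients.\<close>

lemma bernoulli_gen_fps_nth_cong:
  assumes "p dvd m + n" "k < p - 1"
  shows "fps_nth (bernoulli_gen_fps m (- of_int r)) k \<simeq> quot_coeff r n k"
  using assms(2)
proof (induction k rule: less_induct)
  case (less k)
  let ?b = "fps_nth (bernoulli_gen_fps m (- of_int r))"
  obtain z where z: "m + n = p * z" using assms(1) by auto
  have "bernoulli_gen_fps m (- of_int r) * exp_quot ^ (p * z) = exp_quot ^ n * fps_exp (- of_int r)"
    unfolding z[symmetric] power_add mult.assoc[symmetric] bernoulli_gen_fps_exp_quot by (rule mult.commute)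
  then have "quot_coeff r n k = (\<Sum>i=0..k. ?b i * fps_nth (exp_quot ^ (p * z)) (k - i))"
    unfolding quot_coeff_def by (metis fps_mult_nth)
  also have "\<dots> = ?b k * fps_nth (exp_quot ^ (p * z)) 0 + (\<Sum>i\<in>{0..<k}. ?b i * fps_nth (exp_quot ^ (p * z)) (k - i))"
    by (simp add: atLeastLessThanSuc_atLeastAtMost[symmetric])
  also have "fps_nth (exp_quot ^ (p * z)) 0 = 1"
    by (simp add: exp_quot_def fps_power_zeroth)
  also have "?b k * 1 + (\<Sum>i\<in>{0..<k}. ?b i * fps_nth (exp_quot ^ (p * z)) (k - i)) \<simeq> ?b k * 1 + (\<Sum>i\<in>{0..<k}. 0)"
  proof (intro rcong_add rcong_refl rcong_sum)
    fix i assume i: "i \<in> {0..<k}"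
    then have "?b i \<simeq> quot_coeff r n i" "i < p - 1" using less by auto
    then have "pint (?b i)" using rcong_pint pint_quot_coeff by blast
    moreover have "fps_nth (exp_quot ^ (p * z)) (k - i) \<simeq> 0"
      using exp_quot_power_p_mult[of "k - i" z] i less.prems by auto
    ultimately show "?b i * fps_nth (exp_quot ^ (p * z)) (k - i) \<simeq> 0" by (rule rcong_0_mult(2)[rotated])
  qed
  finally show ?case by (simp add: rcong_sym)
qed

end

context fleck_setting
begin

lemma least_nonneg_neg_residue_eq: "least_nonneg_neg_residue p (int n - int l) = \<kappa> l n"
  unfolding least_nonneg_neg_residue_def
proof (rule Least_equality)
  have k: "int (\<kappa> l n) = (int l - int n) mod (int p - 1)"
    unfolding \<kappa>_def using p_gt1 by simp
  show "[int (\<kappa> l n) = - (int n - int l)] (mod int p - 1)"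
    unfolding k by (simp add: cong_def)
  fix y assume "[int y = - (int n - int l)] (mod int p - 1)"
  then have "int (\<kappa> l n) = int y mod (int p - 1)" unfolding k by (simp add: cong_def)
  also have "\<dots> \<le> int y" using p_gt1 by (intro zmod_le_nonneg_dividend) simp
  finally show "\<kappa> l n \<le> y" by simp
qed

lemma smallest_pos_residue_eq: "smallest_pos_residue p (int n - int l) = p - 1 - \<kappa> l n"
  unfolding smallest_pos_residue_def
proof (rule Least_equality)
  have k: "\<kappa> l n < p - 1" by (rule kappa_less)
  have "int (p - 1 - \<kappa> l n) - (int n - int l) = (int p - 1) * (- expo l n)"
    using expo_kappa[of n l] k by (simp add: of_nat_diff algebra_simps)
  then have c: "[int (p - 1 - \<kappa> l n) = int n - int l] (mod int p - 1)"
    by (simp add: cong_iff_dvd_diff)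
  then show "0 < p - 1 - \<kappa> l n \<and> [int (p - 1 - \<kappa> l n) = int n - int l] (mod int p - 1)"
    using k by simp
  fix y assume y: "0 < y \<and> [int y = int n - int l] (mod int p - 1)"
  show "p - 1 - \<kappa> l n \<le> y"
  proof (rule ccontr)
    assume "\<not> p - 1 - \<kappa> l n \<le> y"
    moreover have "(int p - 1) dvd int (p - 1 - \<kappa> l n) - int y"
      using cong_trans[OF c cong_sym] y by (simp add: cong_iff_dvd_diff)
    ultimately show False using y k by (auto dest!: zdvd_imp_le)
  qed
qed

text \<open>The factorial inside the Bernoulli polynomial and the outer one are complementary, so
  Wilson turns their product into a sign. Its parity follows from \<open>expo_kappa\<close>, as p -
  1 is even for odd p.\<close>

lemma fact_bernoulli_cong:
  assumes "p dvd m + n"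
  shows "fact (smallest_pos_residue p (int n - int l))
       * bernoulli_poly m (least_nonneg_neg_residue p (int n - int l)) (- of_int r)
     \<simeq> (- 1) ^ (l + n + 1) * quot_coeff r n (\<kappa> l n)"
proof -
  let ?k = "\<kappa> l n"
  have k: "?k < p - 1" by (rule kappa_less)
  have "fact (p - 1 - ?k) * (fact ?k * fps_nth (bernoulli_gen_fps m (- of_int r)) ?k)
      = (fact ?k * fact (p - 1 - ?k)) * fps_nth (bernoulli_gen_fps m (- of_int r)) ?k"
    by simp
  also have "\<dots> \<simeq> (- 1) ^ Suc ?k * quot_coeff r n ?k"
    using k pint_of_nat[of "fact ?k * fact (p - 1 - ?k)"]
    by (intro rcong_mult fact_mult_fact bernoulli_gen_fps_nth_cong assms pint_quot_coeff) auto
  also have "\<dots> \<simeq> (- 1) ^ (l + n + 1) * quot_coeff r n ?k"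
  proof (intro rcong_mult minus1_power_parity rcong_refl pint_quot_coeff k)
    assume "p \<noteq> 2"
    then have "odd p" using prime_p prime_odd_nat p_gt1 by force
    then have "even (int n + int ?k) \<longleftrightarrow> even (int l)"
      unfolding expo_kappa by simp
    then show "even (Suc ?k) \<longleftrightarrow> even (l + n + 1)" by auto
  qed (rule pint_minus1_power)
  finally show ?thesis
    unfolding least_nonneg_neg_residue_eq smallest_pos_residue_eq bernoulli_poly_def .
qed

lemma expo_nonneg_iff: "expo l n \<ge> 0 \<longleftrightarrow> n > l"
  unfolding expo_def using p_gt1 by (subst pos_imp_zdiv_nonneg_iff) auto

lemma binom_nonneg_eq:
  "binom_nonneg (expo l n) l = of_bool (n > l) * (of_int \<lfloor>(of_int (int n - int l - 1) :: rat) / of_int (int p - 1)\<rfloor> gchoose l)"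
proof -
  have "\<lfloor>(of_int (int n - int l - 1) :: rat) / of_int (int p - 1)\<rfloor> = expo l n"
    unfolding expo_def by (rule floor_divide_of_int_eq)
  moreover have "(of_int (expo l n) gchoose l :: rat) = of_nat (nat (expo l n) choose l)" if "expo l n \<ge> 0"
  proof -
    have "(of_int (expo l n) :: rat) = of_nat (nat (expo l n))" using that by simp
    then show ?thesis by (simp only: binomial_gbinomial)
  qed
  ultimately show ?thesis unfolding binom_nonneg_def using expo_nonneg_iff[of l n] by simp
qed

section \<open>Leading digits of s and t and vanishing of the defect\<close>

lemma floor_divide_Q:
  assumes "a > 1"
  shows "\<lfloor>(of_nat x :: rat) / of_nat p powi (int a - 2)\<rfloor> = int (x div Q)"
proof -
  have "int a - 2 = int (a - 2)" using assms by simp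
  then have "(of_nat p :: rat) powi (int a - 2) = of_nat Q"
    by (simp only: power_int_of_nat of_nat_power)
  then show ?thesis by (simp only: floor_divide_of_nat_eq)
qed

lemma P_eq: "a > 1 \<Longrightarrow> P = Q * p"
proof -
  assume "a > 1"
  then have "a - 1 = Suc (a - 2)" by simp
  then show ?thesis by simp
qed

text \<open>Adding Q * i changes only the leading digit of s, so Lucas to the base Q splits off a
  constant factor from the lower digits.\<close>

lemma defect_factor_cong_digits:
  assumes "a > 1" "s < P"
  shows "defect_factor s \<simeq> (- 1) ^ t * (of_nat (s mod Q choose (t mod Q)) * binom_harmonic (s div Q) (t div Q))"
proof -
  let ?S = "s div Q" and ?T = "t div Q" and ?c = "of_nat (s mod Q choose (t mod Q)) :: rat"
  have lt: "s + Q * i < P \<longleftrightarrow> ?S + i < p" for i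
  proof -
    have "s + Q * i < Q * p \<longleftrightarrow> (s + Q * i) div Q < p"
      using Q_pos by (simp add: div_less_iff_less_mult mult.commute)
    also have "(s + Q * i) div Q = ?S + i"
      using Q_pos by (metis add.commute div_mult_self2 less_irrefl)
    finally show ?thesis unfolding P_eq[OF assms(1)] .
  qed
  have "defect_factor s \<simeq> (\<Sum>i\<in>{1..<p}. if ?S + i < p then (- 1) ^ t * (?c * (of_nat (?S + i choose ?T) / of_nat i)) else 0)"
    unfolding defect_factor_def
  proof (intro rcong_sum)
    fix i assume i: "i \<in> {1..<p}"
    have "s + Q * i = Q * (?S + i) + s mod Q" by (simp add: algebra_simps)
    moreover have "t = Q * ?T + t mod Q" by simp
    ultimately have "of_nat (s + Q * i choose t) \<simeq> of_nat ((?S + i choose ?T) * (s mod Q choose (t mod Q)))"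
      using lucas_prime_power[of "s mod Q" "a - 2" "t mod Q" "?S + i" "?T"] Q_pos by simp
    from rcong_cmult[OF pint_divide_less[OF i pint_minus1_power[of t]] this]
    show "(if s + Q * i < P then (- 1) ^ t * of_nat (s + Q * i choose t) / of_nat i else 0)
      \<simeq> (if ?S + i < p then (- 1) ^ t * (?c * (of_nat (?S + i choose ?T) / of_nat i)) else 0)"
      unfolding lt by (simp add: mult_ac)
  qed
  also have "\<dots> = (- 1) ^ t * (?c * binom_harmonic ?S ?T)"
    unfolding binom_harmonic_def sum_distrib_left by (intro sum.cong) auto
  finally show ?thesis .
qed

lemma defect_factor_cong_0:
  assumes "s < P"
    and "a = 1 \<or> s div Q = 2 * (t div Q) \<and> p \<noteq> 2 \<or> s div Q = p - 1"
  shows "defect_factor s \<simeq> 0"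
proof -
  consider "a = 1" | "a > 1" "s div Q = 2 * (t div Q)" "p \<noteq> 2" | "a > 1" "s div Q = p - 1"
    using assms(2) a_pos by linarith
  then show ?thesis
  proof cases
    case 1
    then show ?thesis unfolding defect_factor_def by simp
  next
    case 2
    have "s div Q < p"
      using assms(1) unfolding P_eq[OF 2(1)] by (simp add: less_mult_imp_div_less mult.commute)
    then have "binom_harmonic (s div Q) (t div Q) \<simeq> 0"
      using binom_harmonic_cong[OF 2(3), of "t div Q" "s div Q"] 2(2) by simp
    then have "(- 1) ^ t * (of_nat (s mod Q choose (t mod Q)) * binom_harmonic (s div Q) (t div Q)) \<simeq> 0"
      by (intro rcong_0_mult(2)) auto
    then show ?thesis using defect_factor_cong_digits[OF 2(1) assms(1)] rcong_trans by blast
  next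
    \<comment> \<open>With leading digit p - 1 every step of Q overflows P, and the sum is
      empty.\<close>
    case 3
    have "P \<le> s + Q * i" if "i \<ge> 1" for i
    proof -
      have "Q * (p - 1) + Q * 1 \<le> s + Q * i"
        using that unfolding 3(2)[symmetric] by (intro add_mono mult_le_mono2) simp_all
      moreover have "Q * (p - 1) + Q * 1 = P"
        unfolding P_eq[OF 3(1)] using p_gt0 by (metis Suc_diff_1 mult_Suc_right add.commute mult_1_right)
      ultimately show ?thesis by simp
    qed
    then have "\<not> s + Q * i < P" if "i \<in> {1..<p}" for i using that by (simp add: not_less)
    then have "defect_factor s = 0" unfolding defect_factor_def by (intro sum.neutral ballI if_not_P)
    then show ?thesis by simp
  qed
qed

text \<open>For exceptional n, eliminating l + 1 leaves p * \<open>expo l n\<close> - n as the first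
  factor of the defect.\<close>

lemma defect_cong_0:
  assumes "exceptional l n" "p dvd n"
  shows "defect l (expo l n - 1) \<simeq> 0"
proof -
  have "expo l n - 1 - int l = int p * expo l n - int n"
    using exceptional_E(1)[OF assms(1)] by (simp add: algebra_simps)
  then have "[expo l n - 1 - int l = 0] (mod int p)"
    using assms(2) by (simp add: cong_0_iff)
  from rcong_of_int[OF this] show ?thesis
    unfolding defect_def by (intro rcong_0_mult(1) pint_binom_nonneg) simp
qed

lemma fleck_cong_regular:
  assumes "s < P"
    and "a = 1 \<or> p dvd n \<or> \<not> exceptional l n \<or> s div Q = 2 * (t div Q) \<and> p \<noteq> 2 \<or> s div Q = p - 1"
  shows "fleck l (P * n + s) \<simeq> (- 1) ^ t * of_nat (s choose t) * bern_side l n"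
proof -
  note N = div_mod_P[OF assms(1), of n]
  have "defect_factor s * (- 1) ^ n * defect l (expo l n - 1) \<simeq> 0" if ex: "exceptional l n"
  proof (cases "p dvd n")
    case True
    then show ?thesis
      using defect_cong_0[OF ex] by (intro rcong_0_mult(2) pint_mult pint_defect_factor) auto
  next
    case False
    then have "defect_factor s \<simeq> 0" using assms ex by (intro defect_factor_cong_0) auto
    then show ?thesis by (intro rcong_0_mult(1) pint_defect) auto
  qed
  then have "fleck_residue l (P * n + s) \<simeq> (- 1) ^ t * of_nat (s choose t) * bern_side l n + 0"
    unfolding fleck_residue_def N by (intro rcong_add rcong_refl) auto
  with fleck_cong[of l "P * n + s"] rcong_trans show ?thesis by simp
qed

end

theorem theorem5p1:
  fixes p a l n m s t :: nat and r :: int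
  assumes "prime p"
    and "0 < a"
    and "s \<in> {0..p ^ (a - 1) - 1}"
    and "t \<in> {0..p ^ (a - 1) - 1}"
    and "[int m = - int n] (mod int p)"
    and "(a = 1 \<or> p dvd n \<or> \<not> (int p - 1) dvd (int n - int l - 1))
       \<or> (\<lfloor>(of_nat s :: rat) / of_nat p powi (int a - 2)\<rfloor>
            = 2 * \<lfloor>(of_nat t :: rat) / of_nat p powi (int a - 2)\<rfloor> \<and> p \<noteq> 2)
       \<or> (\<lfloor>(of_nat s :: rat) / of_nat p powi (int a - 2)\<rfloor> = int p - 1
            \<and> \<lfloor>(of_nat t :: rat) / of_nat p powi (int a - 2)\<rfloor> = int p - 1)"
  shows "rat_cong p
    ((- 1) powi (int l + int t - 1)
       * fleck_quotient p a l (p ^ (a - 1) * n + s) (int (p ^ (a - 1)) * r + int t))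
    (of_bool (n > l) * of_nat (s choose t)
       * (of_int \<lfloor>(of_int (int n - int l - 1) :: rat) / of_int (int p - 1)\<rfloor> gchoose l)
       * fact (smallest_pos_residue p (int n - int l))
       * bernoulli_poly m (least_nonneg_neg_residue p (int n - int l)) (- of_int r))"
proof -
  have p0: "p > 0" using assms(1) prime_gt_0_nat by blast
  then have "p ^ (a - 1) > 0" by simp
  then have st: "s < p ^ (a - 1)" "t < p ^ (a - 1)" using assms(3,4) by (simp_all add: le_less_trans)
  interpret fleck_setting p a t r
    by unfold_locales (use assms(1,2) st in auto)
  have "int p dvd int (m + n)" using assms(5) by (simp add: cong_iff_dvd_diff)
  then have mn: "p dvd m + n" by (simp only: int_dvd_int_iff)
  have "a = 1 \<or> p dvd n \<or> \<not> exceptional l n \<or> s div Q = 2 * (t div Q) \<and> p \<noteq> 2 \<or> s div Q = p - 1"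
  proof (cases "a > 1")
    case True
    then show ?thesis using assms(6) p0 unfolding floor_divide_Q[OF True] exceptional_def by linarith
  next
    case False
    then show ?thesis using assms(2) by simp
  qed
  from fleck_cong_regular[OF st(1) this]
  have lim: "fleck l (P * n + s) \<simeq> (- 1) ^ t * of_nat (s choose t) * bern_side l n" .
  \<comment> \<open>The exponent can be -1, so it is raised by 2 to become a natural number.\<close>
  have sgn: "(- 1 :: rat) powi (int l + int t - 1) = (- 1) ^ (l + t + 1)"
  proof -
    have "int l + int t - 1 = int (l + t + 1) + - 2" by simp
    moreover have "(- 1 :: rat) powi (int (l + t + 1) + - 2) = (- 1) powi int (l + t + 1) * (- 1) powi - 2"
      by (rule power_int_add) simp
    moreover have "(- 1 :: rat) powi - 2 = 1" by (simp add: power_int_minus)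
    ultimately show ?thesis by (simp only: power_int_of_nat mult_1_right)
  qed
  have "(- 1) powi (int l + int t - 1) * fleck_quotient p a l (P * n + s) (int P * r + int t)
     = (- 1) ^ (l + t + 1) * fleck l (P * n + s)"
    unfolding sgn using fleck_quotient_eq[of l "P * n + s"] by (simp add: \<rho>_def)
  also have "\<dots> \<simeq> (- 1) ^ (l + t + 1) * ((- 1) ^ t * of_nat (s choose t) * bern_side l n)"
    by (intro rcong_cmult lim pint_minus1_power)
  also have "\<dots> = of_nat (s choose t) * binom_nonneg (expo l n) l * ((- 1) ^ (l + n + 1) * quot_coeff r n (\<kappa> l n))"
    unfolding bern_side_def by (simp add: power_add mult_ac power_mult_distrib[symmetric] flip: mult.assoc[of "(-1) ^ t" "(-1) ^ t"])
  also have "\<dots> \<simeq> of_nat (s choose t) * binom_nonneg (expo l n) l * (fact (smallest_pos_residue p (int n - int l))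
       * bernoulli_poly m (least_nonneg_neg_residue p (int n - int l)) (- of_int r))"
    by (intro rcong_cmult rcong_sym[OF fact_bernoulli_cong[OF mn]] pint_mult pint_binom_nonneg) simp
  finally show ?thesis unfolding binom_nonneg_eq by (simp only: mult_ac)
qed

end
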